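(* $\#\mathrm{P}_{\{0,1\}}=\#\mathrm{P}_{\mathbb{N}}$ (equality of classes of functions $\{0,1\}^\star\to\mathbb{R}$).
   Context: Weighted counting problem: it is given by a polynomial $p:\mathbb{N}\to\mathbb{N}$ and a function $w:\{0,1\}^\star\times\{0,1\}^\star\to\mathbb{R}$ for which there is a function $v:\{0,1\}^\star\times\{0,1\}^\star\times\mathbb{N}\to\mathbb{Z}$ such that $v(x,u,b)$ is computable in time polynomial in $|x|$, $|u|$ and $b$, and $|w(x,u)-v(x,u,b)/2^b|\le 2^{-b}$ for all $x,u\in\{0,1\}^\star$, $b\in\mathbb{N}$. The problem is to compute, for $x\in\{0,1\}^\star$, the function $f(x)=\sum_{u\in\{0,1\}^{p(|x|)}} w(x,u)$. For $S\subseteq\mathbb{R}$, $\#\mathrm{P}_S$ is the class of all weighted counting problems (identified with the functions $f$ they define) where the range of $w$ is contained in $S$. Here $\mathbb{N}=\{0,1,2,\dots\}$. *)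

theory Defs
  imports Complex_Main "HOL-Computational_Algebra.Polynomial"
begin

text \<open>
  The model of computation is the deterministic multi-tape Turing machine, with tapes that are
  infinite in both directions. Symbols are natural numbers: 0 is the blank, 1 and 2
  stand for the bits 0 and 1, and further symbols up to the alphabet size may be used as working
  symbols. A tape consists of its contents and the position of the head.
\<close>

type_synonym tape = "(int \<Rightarrow> nat) \<times> int"

datatype move = Move_Left | Stay | Move_Right

text \<open>
  The states are the numbers below \<open>num_states\<close>, of which 0 is the start state, together with
  the halting state \<open>num_states\<close> itself. The transition function maps a non-halting state and
  the list of scanned symbols (one per tape) to the next state and, for each tape, the symbol to
  be written and the subsequent head movement.
\<close>

record tm =
  num_tapes :: nat
  num_symbols :: nat
  num_states :: nat
  delta :: "nat \<Rightarrow> nat list \<Rightarrow> nat \<times> (nat \<times> move) list"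

definition wf_tm :: "tm \<Rightarrow> bool" where
  "wf_tm M \<longleftrightarrow> 3 \<le> num_symbols M \<and>
     (\<forall>q ss. q < num_states M \<longrightarrow> length ss = num_tapes M \<longrightarrow> (\<forall>s\<in>set ss. s < num_symbols M) \<longrightarrow>
       (case delta M q ss of (q', acts) \<Rightarrow>
          q' \<le> num_states M \<and> length acts = num_tapes M \<and>
          (\<forall>(s, d)\<in>set acts. s < num_symbols M)))"

definition scanned :: "tape \<Rightarrow> nat" where
  "scanned tp = fst tp (snd tp)"

fun displacement :: "move \<Rightarrow> int" where
  "displacement Move_Left = -1"
| "displacement Stay = 0"
| "displacement Move_Right = 1"

fun act :: "nat \<times> move \<Rightarrow> tape \<Rightarrow> tape" where
  "act (s, d) (c, h) = (c(h := s), h + displacement d)"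

type_synonym config = "nat \<times> tape list"

fun step :: "tm \<Rightarrow> config \<Rightarrow> config" where
  "step M (q, tps) =
     (if q < num_states M
      then case delta M q (map scanned tps) of (q', acts) \<Rightarrow> (q', map2 act acts tps)
      else (q, tps))"

fun bit_symbol :: "bool \<Rightarrow> nat" where
  "bit_symbol False = 1"
| "bit_symbol True = 2"

definition input_tape :: "bool list \<Rightarrow> tape" where
  "input_tape xs =
     ((\<lambda>i. if 0 \<le> i \<and> i < int (length xs) then bit_symbol (xs ! nat i) else 0), 0)"

definition initial_config :: "tm \<Rightarrow> bool list list \<Rightarrow> config" where
  "initial_config M xss =
     (0, map input_tape xss @ replicate (num_tapes M - length xss) (input_tape []))"

text \<open>The output word extends from the head position up to the first blank to its right.\<close>

definition tape_output :: "tape \<Rightarrow> bool list \<Rightarrow> bool" where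
  "tape_output tp ys \<longleftrightarrow>
     (\<forall>i<length ys. fst tp (snd tp + int i) = bit_symbol (ys ! i)) \<and>
     fst tp (snd tp + int (length ys)) = 0"

text \<open>
  The arguments are placed on the first tapes, one on each, and the result is read off the next
  tape. The halting state is never left, so halting after exactly \<open>t\<close> iterations of \<open>step\<close> means
  halting after at most \<open>t\<close> steps.
\<close>

definition outputs_within :: "tm \<Rightarrow> bool list list \<Rightarrow> nat \<Rightarrow> bool list \<Rightarrow> bool" where
  "outputs_within M xss t ys \<longleftrightarrow>
     (case (step M ^^ t) (initial_config M xss) of (q, tps) \<Rightarrow>
        q = num_states M \<and> tape_output (tps ! length xss) ys)"

text \<open>Integers are represented by a sign bit followed by the magnitude in binary, least significant
  bit first; superfluous zeros are allowed, and the empty word represents 0.\<close>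

fun int_of_bits :: "bool list \<Rightarrow> int" where
  "int_of_bits [] = 0"
| "int_of_bits (s # bs) = (if s then - 1 else 1) * horner_sum of_bool 2 bs"

text \<open>
  The argument \<open>b\<close> is given in unary, since the time bound is polynomial in \<open>b\<close> itself. Up to
  domination, the polynomials in several nonnegative quantities are the univariate polynomials
  in their sum.
\<close>

definition polytime_computable :: "(bool list \<times> bool list \<times> nat \<Rightarrow> int) \<Rightarrow> bool" where
  "polytime_computable v \<longleftrightarrow>
     (\<exists>M (T :: nat poly). wf_tm M \<and> 4 \<le> num_tapes M \<and>
        (\<forall>x u b. \<exists>ys. outputs_within M [x, u, replicate b True] (poly T (length x + length u + b)) ys \<and>
                      int_of_bits ys = v (x, u, b)))"

text \<open>Polynomials such as \<open>n * (n - 1) / 2\<close> map \<open>\<nat>\<close> to \<open>\<nat>\<close> without having coefficients in \<open>\<nat>\<close>.\<close>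

definition polynomial_nat :: "(nat \<Rightarrow> nat) \<Rightarrow> bool" where
  "polynomial_nat p \<longleftrightarrow> (\<exists>P :: real poly. \<forall>n. real (p n) = poly P (real n))"

definition polytime_approximable :: "(bool list \<times> bool list \<Rightarrow> real) \<Rightarrow> bool" where
  "polytime_approximable w \<longleftrightarrow>
     (\<exists>v. polytime_computable v \<and>
        (\<forall>x u b. \<bar>w (x, u) - real_of_int (v (x, u, b)) / 2 ^ b\<bar> \<le> 1 / 2 ^ b))"

definition weighted_counting_problem ::
    "(nat \<Rightarrow> nat) \<Rightarrow> (bool list \<times> bool list \<Rightarrow> real) \<Rightarrow> bool" where
  "weighted_counting_problem p w \<longleftrightarrow> polynomial_nat p \<and> polytime_approximable w"

definition weighted_count ::
    "(nat \<Rightarrow> nat) \<Rightarrow> (bool list \<times> bool list \<Rightarrow> real) \<Rightarrow> bool list \<Rightarrow> real" where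
  "weighted_count p w x = (\<Sum>u | length u = p (length x). w (x, u))"

definition sharp_P :: "real set \<Rightarrow> (bool list \<Rightarrow> real) set" where
  "sharp_P S = {weighted_count p w | p w. weighted_counting_problem p w \<and> range w \<subseteq> S}"

end

theory Submission
  imports Defs
begin

text \<open>
  Approximating a natural number \<open>w\<close> to two binary places gives \<open>v\<close> with \<open>\<bar>4 * w - v\<bar> \<le> 1\<close>, hence
  \<open>w = (v + 1) div 4\<close>. The witness \<open>u\<close> is lengthened to \<open>y @ u\<close>, where \<open>y = 0...01z\<close> stands for the
  claim that bit \<open>length z\<close> of \<open>w (x, u)\<close> is set; as \<open>2 ^ i\<close> words \<open>y\<close> stand for bit \<open>i\<close>, the true claims
  number exactly \<open>w (x, u)\<close>. With \<open>length y = (length x + 2) ^ k\<close> for a large \<open>k\<close>, all bits are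
  covered, and a machine that never computes \<open>p\<close> can find the border between \<open>y\<close> and \<open>u\<close> by
  counting \<open>y\<close> off with \<open>k\<close> nested sweeps over \<open>x\<close>.
\<close>

section \<open>Tapes relative to the head position\<close>

text \<open>Two binary places are the least precision that works: with one place,
  \<open>2 * w + 1\<close> would be a legal answer for both \<open>w\<close> and
  \<open>w + 1\<close>. Comparing \<open>y\<close> with \<open>w (x, u)\<close> as numbers would
  give the right count too, but selecting a bit takes only a counter that runs along the output of
  \<open>M\<close> and one carry. That finitely many bits suffice is due to time: a machine writes
  at most one cell of a tape per step, so a power that dominates the running time of
  \<open>M\<close> also bounds the length of its output. The base is \<open>length x + 2\<close>,
  which is at least 2 even for the empty word, so that its powers dominate every polynomial without
  exception. Computability is demanded for all \<open>u\<close>, including those too short to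
  contain \<open>y\<close>. The accepted pairs are therefore described by \<open>take\<close> and
  \<open>drop\<close>, which make sense for every length. Finally, \<open>M\<close> has to be
  started at the border between \<open>y\<close> and \<open>u\<close> instead of cell 0, which
  requires its runs to be invariant under translation of each tape.\<close>

definition view :: "tape \<Rightarrow> int \<Rightarrow> nat" where
  "view tp i = fst tp (snd tp + i)"

lemma scanned_view: "scanned tp = view tp 0"
  by (simp add: scanned_def view_def)

lemma scanned_Pair [simp]: "scanned (c, h) = c h"
  by (simp add: scanned_def)

lemma view_act: "view (act (s, d) tp) = (\<lambda>i. ((view tp)(0 := s)) (displacement d + i))"
  by (cases tp) (auto simp: view_def fun_eq_iff algebra_simps)

lemma view_act_cong:
  assumes "view tp = view tp'"
  shows "view (act a tp) = view (act a tp')"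
  using assms by (cases a) (simp only: view_act)

lemma map_view_act_cong:
  assumes "map view tps = map view tps'"
  shows "map view (map2 act acts tps) = map view (map2 act acts tps')"
proof -
  have "list_all2 (\<lambda>a b. view a = view b) tps tps'"
    using assms by (simp add: list_all2_conv_all_nth list_eq_iff_nth_eq)
  then show ?thesis
  proof (induction arbitrary: acts rule: list_all2_induct)
    case (Cons a as b bs)
    then show ?case by (cases acts) (auto intro: view_act_cong)
  qed simp
qed

lemma step_view_cong:
  assumes "map view tps = map view tps'"
  shows "fst (step M (q, tps)) = fst (step M (q, tps')) \<and>
    map view (snd (step M (q, tps))) = map view (snd (step M (q, tps')))"
proof -
  have "map scanned tps = map (\<lambda>f. f 0) (map view tps)" for tps :: "tape list"
    by (simp add: scanned_view)
  then have "map scanned tps = map scanned tps'" by (simp only: assms)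
  then show ?thesis
    using map_view_act_cong[OF assms] assms by (simp split: prod.split)
qed

text \<open>A machine sees only the scanned symbols and moves its heads by relative amounts, so
  shifting each tape together with its head changes nothing it can observe. This allows
  \<open>M\<close> to run on tapes whose heads are away from cell 0.\<close>

lemma funpow_step_view_cong:
  assumes "map view tps = map view tps'"
  shows "fst ((step M ^^ n) (q, tps)) = fst ((step M ^^ n) (q, tps')) \<and>
    map view (snd ((step M ^^ n) (q, tps))) = map view (snd ((step M ^^ n) (q, tps')))"
proof (induction n)
  case 0
  then show ?case using assms by simp
next
  case (Suc n)
  obtain q1 tps1 where c1: "(step M ^^ n) (q, tps) = (q1, tps1)" by fastforce
  obtain q2 tps2 where c2: "(step M ^^ n) (q, tps') = (q2, tps2)" by fastforce
  have "q1 = q2" "map view tps1 = map view tps2" using Suc c1 c2 by auto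
  then show ?case
    using step_view_cong[of tps1 tps2 M q1] c1 c2 by (simp del: step.simps)
qed

lemma tape_output_view:
  "tape_output tp ys \<longleftrightarrow>
     (\<forall>i<length ys. view tp (int i) = bit_symbol (ys ! i)) \<and> view tp (int (length ys)) = 0"
  by (simp add: tape_output_def view_def)

abbreviation hold :: "nat \<Rightarrow> nat \<times> move" where
  "hold s \<equiv> (s, Stay)"

lemma act_hold [simp]: "act (hold (scanned tp)) tp = tp"
  by (cases tp) simp

lemma map2_act_hold [simp]: "map2 act (map (hold \<circ> scanned) tps) tps = tps"
  by (induction tps) auto

section \<open>Well-formed configurations\<close>

text \<open>A transition function is constrained on legal states and symbols only, so these bounds
  have to be carried along every run.\<close>

definition wf_config :: "tm \<Rightarrow> config \<Rightarrow> bool" where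
  "wf_config M cfg \<longleftrightarrow> fst cfg \<le> num_states M \<and> length (snd cfg) = num_tapes M \<and>
     (\<forall>tp\<in>set (snd cfg). \<forall>i. fst tp i < num_symbols M)"

lemma wf_config_delta:
  assumes "wf_tm M" "wf_config M (q, tps)" "q < num_states M"
    "delta M q (map scanned tps) = (q', acts)"
  shows "q' \<le> num_states M" "length acts = num_tapes M" "\<forall>(s, d)\<in>set acts. s < num_symbols M"
proof -
  have "\<forall>s\<in>set (map scanned tps). s < num_symbols M"
    using assms(2) by (auto simp: wf_config_def scanned_def)
  moreover have "length (map scanned tps) = num_tapes M"
    using assms(2) by (simp add: wf_config_def)
  ultimately have "case delta M q (map scanned tps) of (q', acts) \<Rightarrow>
      q' \<le> num_states M \<and> length acts = num_tapes M \<and> (\<forall>(s, d)\<in>set acts. s < num_symbols M)"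
    using assms(3) assms(1)[unfolded wf_tm_def, THEN conjunct2, THEN spec, THEN spec, of q "map scanned tps"]
    by simp
  then show "q' \<le> num_states M" "length acts = num_tapes M" "\<forall>(s, d)\<in>set acts. s < num_symbols M"
    using assms(4) by auto
qed

lemma wf_config_step:
  assumes "wf_tm M" "wf_config M cfg"
  shows "wf_config M (step M cfg)"
proof (cases cfg)
  case (Pair q tps)
  show ?thesis
  proof (cases "q < num_states M")
    case True
    obtain q' acts where d: "delta M q (map scanned tps) = (q', acts)" by fastforce
    note * = wf_config_delta[OF assms(1) assms(2)[unfolded Pair] True d]
    have "fst (act a tp) i < num_symbols M" if "(a, tp) \<in> set (zip acts tps)" for a tp i
    proof -
      obtain s e where a: "a = (s, e)" by fastforce
      obtain c h where tp: "tp = (c, h)" by fastforce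
      have "(s, e) \<in> set acts" "(c, h) \<in> set tps"
        using that a tp by (auto dest: set_zip_leftD set_zip_rightD)
      then have "s < num_symbols M" "c i < num_symbols M"
        using *(3) assms(2) Pair by (auto simp: wf_config_def)
      then show ?thesis using a tp by simp
    qed
    then show ?thesis
      using True d * assms(2) Pair by (auto simp: wf_config_def)
  qed (use assms Pair in simp)
qed

lemma wf_config_funpow_step: "wf_tm M \<Longrightarrow> wf_config M cfg \<Longrightarrow> wf_config M ((step M ^^ n) cfg)"
  by (induction n) (auto intro: wf_config_step)

lemma bit_symbol_less: "bit_symbol b < 3"
  by (cases b) auto

lemma bit_symbol_pos [simp]: "0 < bit_symbol b"
  by (cases b) auto

lemma bit_symbol_eq_2_iff [simp]: "bit_symbol b = 2 \<longleftrightarrow> b"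
  by (cases b) auto

lemma wf_config_initial:
  assumes "wf_tm M" "length xss \<le> num_tapes M"
  shows "wf_config M (initial_config M xss)"
proof -
  have "fst (input_tape xs) i < num_symbols M" for xs i
    using assms(1) bit_symbol_less[of "xs ! nat i"] by (auto simp: input_tape_def wf_tm_def)
  then show ?thesis
    using assms by (auto simp: wf_config_def initial_config_def)
qed

lemma funpow_step_halted: "(step M ^^ t) (num_states M, tps) = (num_states M, tps)"
  by (induction t) auto

lemma outputs_within_mono:
  assumes "outputs_within M xss t ys" "t \<le> t'"
  shows "outputs_within M xss t' ys"
proof -
  obtain q tps where c: "(step M ^^ t) (initial_config M xss) = (q, tps)" by fastforce
  then have q: "q = num_states M" using assms(1) by (simp add: outputs_within_def)
  have "(step M ^^ t') (initial_config M xss) =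
      (step M ^^ (t' - t)) ((step M ^^ t) (initial_config M xss))"
    using assms(2) by (simp flip: funpow_add[THEN fun_cong, unfolded comp_def])
  also have "\<dots> = (num_states M, tps)"
    by (simp only: c q funpow_step_halted)
  finally show ?thesis using assms(1) c q by (simp add: outputs_within_def)
qed

section \<open>The length of the output\<close>

text \<open>A step changes a tape in the cell under the head only, so the set of nonblank cells
  gains at most one element. Counting cells avoids any reasoning about where the head stands when
  the output is read.\<close>

lemma support_funpow_step:
  assumes "wf_tm M" "wf_config M cfg" "j < num_tapes M" "fst (snd cfg ! j) = (\<lambda>_. 0)"
  shows "finite {i. fst (snd ((step M ^^ t) cfg) ! j) i \<noteq> 0} \<and>
    card {i. fst (snd ((step M ^^ t) cfg) ! j) i \<noteq> 0} \<le> t"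
proof (induction t)
  case 0
  then show ?case using assms(4) by simp
next
  case (Suc t)
  obtain q tps where c: "(step M ^^ t) cfg = (q, tps)" by fastforce
  have wf: "wf_config M (q, tps)"
    using wf_config_funpow_step[OF assms(1,2), of t] c by simp
  show ?case
  proof (cases "q < num_states M")
    case True
    obtain q' acts where d: "delta M q (map scanned tps) = (q', acts)" by fastforce
    note * = wf_config_delta[OF assms(1) wf True d]
    obtain s e where a: "acts ! j = (s, e)" by fastforce
    obtain g h where g: "tps ! j = (g, h)" by fastforce
    have len: "length tps = num_tapes M" using wf by (simp add: wf_config_def)
    have "{i. fst (snd ((step M ^^ Suc t) cfg) ! j) i \<noteq> 0} \<subseteq> insert h {i. g i \<noteq> 0}"
      using True d c *(2) assms(3) len a g by (auto split: if_splits)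
    moreover have "finite {i. g i \<noteq> 0}" "card {i. g i \<noteq> 0} \<le> t"
      using Suc c g by auto
    moreover have "card (insert h {i. g i \<noteq> 0}) \<le> Suc (card {i. g i \<noteq> 0})"
      using \<open>finite {i. g i \<noteq> 0}\<close> by (simp add: card_insert_if)
    ultimately show ?thesis
      by (meson card_mono finite_insert finite_subset le_trans Suc_le_mono)
  qed (use Suc c in simp)
qed

lemma length_output_le:
  assumes "wf_tm M" "length xss < num_tapes M" "outputs_within M xss t ys"
  shows "length ys \<le> t"
proof -
  define tp where "tp = snd ((step M ^^ t) (initial_config M xss)) ! length xss"
  have out: "tape_output tp ys"
    using assms(3) by (auto simp: outputs_within_def tp_def split: prod.splits)
  have "finite {i. fst tp i \<noteq> 0} \<and> card {i. fst tp i \<noteq> 0} \<le> t"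
    unfolding tp_def using assms(2)
    by (intro support_funpow_step assms wf_config_initial)
      (auto simp: initial_config_def nth_append input_tape_def)
  moreover have "(\<lambda>i. snd tp + int i) ` {..<length ys} \<subseteq> {i. fst tp i \<noteq> 0}"
    using out by (auto simp: tape_output_def)
  moreover have "card ((\<lambda>i. snd tp + int i) ` {..<length ys}) = length ys"
    by (subst card_image) (auto simp: inj_on_def)
  ultimately show ?thesis by (metis card_mono le_trans)
qed

section \<open>Machines with arbitrary finite state sets\<close>

type_synonym 's transition = "'s \<Rightarrow> nat list \<Rightarrow> 's option \<times> (nat \<times> move) list"

fun run_step :: "'s transition \<Rightarrow> 's option \<times> tape list \<Rightarrow> 's option \<times> tape list" where
  "run_step \<delta> (None, tps) = (None, tps)"
| "run_step \<delta> (Some s, tps) =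
     (case \<delta> s (map scanned tps) of (s', acts) \<Rightarrow> (s', map2 act acts tps))"

text \<open>States may be structured data here; they are numbered, with \<open>None\<close> as the
  halting state. Closure of \<open>Q\<close> is required for arbitrary scanned symbols, so that the
  translation of runs needs no invariant on the tapes.\<close>

lemma tm_of_transition:
  fixes \<delta> :: "'s transition"
  assumes fin: "finite Q" and s0: "s0 \<in> Q" and G: "3 \<le> G"
    and closed: "\<And>s ss. s \<in> Q \<Longrightarrow> fst (\<delta> s ss) \<in> insert None (Some ` Q)"
    and acts: "\<And>s ss. s \<in> Q \<Longrightarrow> length ss = K \<Longrightarrow> \<forall>a\<in>set ss. a < G \<Longrightarrow>
      length (snd (\<delta> s ss)) = K \<and> (\<forall>(a, d)\<in>set (snd (\<delta> s ss)). a < G)"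
  obtains N where "wf_tm N" "num_tapes N = K"
    "\<And>t tps tps'. (run_step \<delta> ^^ t) (Some s0, tps) = (None, tps') \<Longrightarrow>
      (step N ^^ t) (0, tps) = (num_states N, tps')"
proof -
  obtain f where f: "bij_betw f Q {0..<card Q}"
    using ex_bij_betw_finite_nat[OF fin] by blast
  \<comment> \<open>The start state must get number 0: \<open>h\<close> is \<open>f\<close> followed
    by the transposition of 0 and \<open>f s0\<close>.\<close>
  define h where "h s = (if f s = 0 then f s0 else if f s = f s0 then 0 else f s)" for s
  have pos: "f s0 < card Q" using f s0 by (auto simp: bij_betw_def)
  have injf: "inj_on f Q" using f by (simp add: bij_betw_def)
  have h0: "h s0 = 0" by (simp add: h_def)
  have injh: "inj_on h Q"
    using injf by (auto simp: inj_on_def h_def split: if_splits)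
  have hQ: "h s < card Q" if "s \<in> Q" for s
    using f that pos by (auto simp: h_def bij_betw_def)
  have surj: "\<exists>s\<in>Q. h s = q" if "q < card Q" for q
  proof -
    have "h ` Q \<subseteq> {..<card Q}" using hQ by auto
    moreover have "card (h ` Q) = card Q" using injh by (rule card_image)
    ultimately have "h ` Q = {..<card Q}" by (intro card_subset_eq) auto
    then show ?thesis using that by (metis imageE lessThan_iff)
  qed
  define enc where "enc s = (case s of None \<Rightarrow> card Q | Some s \<Rightarrow> h s)" for s
  define dec where "dec = inv_into Q h"
  have dec: "dec (h s) = s" if "s \<in> Q" for s
    using injh that by (simp add: dec_def)
  have encQ: "enc s \<le> card Q" if "s \<in> insert None (Some ` Q)" for s
    using that hQ by (force simp: enc_def)
  define N where "N = \<lparr>num_tapes = K, num_symbols = G, num_states = card Q,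
    delta = (\<lambda>q ss. case \<delta> (dec q) ss of (s', as) \<Rightarrow> (enc s', as))\<rparr>"
  have "wf_tm N"
    unfolding wf_tm_def
  proof (intro conjI allI impI)
    show "3 \<le> num_symbols N" using G by (simp add: N_def)
    fix q ss
    assume q: "q < num_states N" and ss: "length ss = num_tapes N" "\<forall>s\<in>set ss. s < num_symbols N"
    obtain s where s: "s \<in> Q" "h s = q" using surj q by (auto simp: N_def)
    have d: "dec q = s" using s dec by auto
    obtain s' as where e: "\<delta> s ss = (s', as)" by fastforce
    then show "case delta N q ss of (q', acts) \<Rightarrow> q' \<le> num_states N \<and>
        length acts = num_tapes N \<and> (\<forall>(s, d)\<in>set acts. s < num_symbols N)"
      using d closed[OF s(1), of ss] acts[OF s(1), of ss] ss encQ[of s'] by (simp add: N_def)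
  qed
  moreover have "num_tapes N = K" by (simp add: N_def)
  moreover have "fst ((run_step \<delta> ^^ t) (Some s0, tps)) \<in> insert None (Some ` Q) \<and>
      (step N ^^ t) (0, tps) = map_prod enc id ((run_step \<delta> ^^ t) (Some s0, tps))" for t tps
  proof (induction t)
    case 0
    then show ?case using s0 h0 by (simp add: enc_def)
  next
    case (Suc t)
    obtain s tps1 where c: "(run_step \<delta> ^^ t) (Some s0, tps) = (s, tps1)" by fastforce
    show ?case
    proof (cases s)
      case None
      then show ?thesis using Suc c by (simp add: enc_def N_def)
    next
      case (Some r)
      then have r: "r \<in> Q" using Suc c by auto
      show ?thesis
        using Suc c Some r dec[OF r] hQ[OF r] closed[OF r, of "map scanned tps1"]
        by (auto simp: enc_def N_def split: prod.splits)
    qed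
  qed
  then have "(step N ^^ t) (0, tps) = (num_states N, tps')"
    if "(run_step \<delta> ^^ t) (Some s0, tps) = (None, tps')" for t tps tps'
    using that by (simp add: enc_def N_def)
  ultimately show ?thesis using that by blast
qed

section \<open>Counting words that select a bit\<close>

text \<open>Ripple-carry addition of \<open>c\<close>, one bit per call, in the form in which a
  machine performs it. Missing bits count as 0, so \<open>m\<close> may exceed the length of
  \<open>bs\<close>.\<close>

fun carry_bit :: "bool list \<Rightarrow> nat \<Rightarrow> bool \<Rightarrow> bool" where
  "carry_bit bs 0 c \<longleftrightarrow> (bs \<noteq> [] \<and> hd bs) \<noteq> c"
| "carry_bit bs (Suc m) c \<longleftrightarrow> carry_bit (tl bs) m ((bs \<noteq> [] \<and> hd bs) \<and> c)"

lemma carry_bit_iff: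
  "carry_bit bs m c \<longleftrightarrow> odd ((horner_sum of_bool 2 bs + of_bool c :: nat) div 2 ^ m)"
proof (induction m arbitrary: bs c)
  case 0
  then show ?case by (cases bs) auto
next
  case (Suc m)
  have "(horner_sum of_bool 2 bs + of_bool c :: nat) div 2 =
      horner_sum of_bool 2 (tl bs) + of_bool ((bs \<noteq> [] \<and> hd bs) \<and> c)"
    by (cases bs) auto
  then show ?case by (simp add: Suc div_mult2_eq)
qed

lemma int_horner_sum: "int (horner_sum of_bool 2 bs) = horner_sum of_bool 2 bs"
  by (induction bs) auto

lemma horner_sum_less: "horner_sum of_bool 2 bs < (2 :: nat) ^ length bs"
proof (induction bs)
  case (Cons b bs)
  then show ?case by (cases b) auto
qed simp

lemma int_of_bits_single: "int_of_bits (False # replicate b False @ [r]) = (if r then 2 ^ b else 0)"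
proof -
  have "horner_sum of_bool 2 (replicate b False @ [r]) = (if r then 2 ^ b else 0 :: int)"
    by (induction b) auto
  then show ?thesis by simp
qed

text \<open>
  A word 0...01z of length \<open>q\<close> selects bit \<open>length z\<close> of \<open>W\<close>, and bit \<open>i\<close> is selected by exactly
  \<open>2 ^ i\<close> words.
\<close>

definition selected_bit :: "bool list \<Rightarrow> nat \<Rightarrow> bool" where
  "selected_bit y W \<longleftrightarrow> dropWhile Not y \<noteq> [] \<and> odd (W div 2 ^ (length (dropWhile Not y) - 1))"

lemma finite_length_eq: "finite {u :: bool list. length u = n}"
  using finite_lists_length_eq[of "UNIV :: bool set" n] by simp

lemma card_length_eq: "card {u :: bool list. length u = n} = 2 ^ n"
  using card_lists_length_eq[of "UNIV :: bool set" n] by simp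

text \<open>Split by the first letter. All \<open>2 ^ q\<close> words \<open>True # y\<close> select
  bit \<open>q\<close>, whereas \<open>False # y\<close> selects the same bit as \<open>y\<close>;
  together they give the binary expansion of \<open>W\<close> below
  \<open>2 ^ Suc q\<close>.\<close>

lemma sum_selected_bit:
  "(\<Sum>y | length y = q. of_bool (selected_bit y W)) = W mod 2 ^ q"
proof (induction q)
  case 0
  then show ?case by (simp add: selected_bit_def)
next
  case (Suc q)
  let ?A = "{y :: bool list. length y = q}"
  have "{y. length y = Suc q} = Cons True ` ?A \<union> Cons False ` ?A"
    by (auto simp: length_Suc_conv image_iff)
  then have "(\<Sum>y | length y = Suc q. of_bool (selected_bit y W)) =
      (\<Sum>y \<in> Cons True ` ?A. of_bool (selected_bit y W)) +
      (\<Sum>y \<in> Cons False ` ?A. of_bool (selected_bit y W) :: nat)"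
    by (simp only:) (intro sum.union_disjoint, auto simp: finite_length_eq)
  also have "(\<Sum>y \<in> Cons True ` ?A. of_bool (selected_bit y W)) =
      (\<Sum>y \<in> ?A. of_bool (selected_bit (True # y) W) :: nat)"
    by (subst sum.reindex) auto
  also have "\<dots> = (\<Sum>y \<in> ?A. W div 2 ^ q mod 2)"
    by (intro sum.cong) (auto simp: selected_bit_def of_bool_odd_eq_mod_2)
  also have "\<dots> = 2 ^ q * (W div 2 ^ q mod 2)"
    by (simp add: card_length_eq)
  also have "(\<Sum>y \<in> Cons False ` ?A. of_bool (selected_bit y W)) =
      (\<Sum>y \<in> ?A. of_bool (selected_bit y W) :: nat)"
    by (subst sum.reindex) (auto simp: selected_bit_def)
  also have "\<dots> = W mod 2 ^ q" by (rule Suc)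
  also have "2 ^ q * (W div 2 ^ q mod 2) + W mod 2 ^ q = W mod 2 ^ Suc q"
    by (simp only: power_Suc2 mod_mult2_eq)
  finally show ?case .
qed

lemma sum_length_add:
  "(\<Sum>u | length u = q + p. F (take q u) (drop q u)) =
    (\<Sum>u | length u = p. \<Sum>y | length (y :: bool list) = q. F y u)"
  for F :: "bool list \<Rightarrow> bool list \<Rightarrow> 'a :: comm_monoid_add"
proof -
  have "bij_betw (\<lambda>(u, y). y @ u) ({u. length u = p} \<times> {y. length y = q})
      {u :: bool list. length u = q + p}"
    by (rule bij_betw_byWitness[where f' = "\<lambda>u. (drop q u, take q u)"]) auto
  then have "(\<Sum>u | length u = q + p. F (take q u) (drop q u)) =
      (\<Sum>(u, y) \<in> {u. length u = p} \<times> {y. length y = q}. F y u)"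
    by (subst sum.reindex_bij_betw[symmetric]) (auto intro!: sum.cong)
  then show ?thesis by (simp add: sum.cartesian_product)
qed

section \<open>Bounds by powers\<close>

lemma poly_le_power:
  fixes P :: "real poly"
  shows "\<exists>k. \<forall>n. \<bar>poly P (real n)\<bar> \<le> real (n + 2) ^ k"
proof (induction P)
  case 0
  then show ?case by simp
next
  case (pCons a P)
  then obtain k where k: "\<And>n. \<bar>poly P (real n)\<bar> \<le> real (n + 2) ^ k" by auto
  \<comment> \<open>As the base \<open>n + 2\<close> is at least 2, \<open>m\<close> further factors
    absorb the coefficient \<open>a\<close>, and one more absorbs the multiplication by
    \<open>n\<close>.\<close>
  obtain m where m: "\<bar>a\<bar> < 2 ^ m" using real_arch_pow[of 2 "\<bar>a\<bar>"] by auto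
  have "\<bar>poly (pCons a P) (real n)\<bar> \<le> real (n + 2) ^ (k + m + 1)" for n
  proof -
    have "\<bar>a\<bar> \<le> real (n + 2) ^ m"
      using m power_mono[of 2 "real (n + 2)" m] by simp
    also have "\<dots> \<le> real (n + 2) ^ (k + m)" by (intro power_increasing) auto
    finally have 1: "\<bar>a\<bar> \<le> real (n + 2) ^ (k + m)" .
    have "\<bar>poly P (real n)\<bar> \<le> real (n + 2) ^ (k + m)"
      using k[of n] power_increasing[of k "k + m" "real (n + 2)"] by linarith
    then have 2: "real n * \<bar>poly P (real n)\<bar> \<le> real n * real (n + 2) ^ (k + m)"
      by (intro mult_left_mono) auto
    have "\<bar>poly (pCons a P) (real n)\<bar> \<le> \<bar>a\<bar> + real n * \<bar>poly P (real n)\<bar>"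
      using abs_triangle_ineq[of a "real n * poly P (real n)"] by (simp add: abs_mult)
    also have "\<dots> \<le> (1 + real n) * real (n + 2) ^ (k + m)"
      using 1 2 by (simp add: algebra_simps)
    also have "\<dots> \<le> real (n + 2) * real (n + 2) ^ (k + m)"
      by (intro mult_right_mono) auto
    finally show ?thesis by (simp add: mult.commute)
  qed
  then show ?case by blast
qed

lemma poly_of_nat: "real (poly T n) = poly (map_poly real T) (real n)"
  by (induction T) (auto simp: map_poly_pCons)

lemma polynomial_nat_le_power:
  assumes "polynomial_nat p"
  shows "\<exists>k. \<forall>n. poly T (n + p n + 2) \<le> (n + 2) ^ k"
proof -
  obtain P where P: "\<And>n. real (p n) = poly P (real n)"
    using assms by (auto simp: polynomial_nat_def)
  \<comment> \<open>The composition is formed over the reals because \<open>P\<close> need not have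
    natural coefficients; \<open>[:2, 1:] + P\<close> is the input size \<open>n + p n + 2\<close>
    of \<open>M\<close> at precision 2.\<close>
  obtain k where k: "\<And>n. \<bar>poly (pcompose (map_poly real T) ([:2, 1:] + P)) (real n)\<bar> \<le> real (n + 2) ^ k"
    using poly_le_power by blast
  have "poly T (n + p n + 2) \<le> (n + 2) ^ k" for n
  proof -
    have "real (poly T (n + p n + 2)) \<le> real (n + 2) ^ k"
      using k[of n] by (simp add: poly_of_nat poly_pcompose P algebra_simps)
    also have "\<dots> = real ((n + 2) ^ k)" by simp
    finally show ?thesis by (simp only: of_nat_le_iff)
  qed
  then show ?thesis by blast
qed

lemma poly_mono_nat: "m \<le> n \<Longrightarrow> poly T m \<le> poly T n" for T :: "nat poly"
  by (induction T) (auto intro!: mult_mono add_mono)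

section \<open>The odometer\<close>

text \<open>
  A digit is a head that sweeps back and forth over a block of \<open>m\<close> nonblank cells, a carry being
  issued on the blank at either end; a direction is \<open>True\<close> when it is rightward. The number of
  moves left until the next carry ranges over \<open>0..m\<close>, so the machine never has to rewind and
  counts down in base \<open>m + 1\<close>, one per step.
\<close>

definition sweep :: "bool \<Rightarrow> move" where
  "sweep d = (if d then Move_Right else Move_Left)"

fun odo_step :: "bool list \<Rightarrow> nat list \<Rightarrow> bool list \<times> (nat \<times> move) list \<times> bool" where
  "odo_step (d # ds) (s # ss) =
     (if s \<noteq> 0 then (d # ds, (s, sweep d) # map hold ss, False)
      else case odo_step ds ss of (ds', as, c) \<Rightarrow> ((\<not> d) # ds', (s, sweep (\<not> d)) # as, c))"
| "odo_step ds ss = (ds, map hold ss, True)"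

fun digit :: "nat \<Rightarrow> bool \<Rightarrow> int \<Rightarrow> nat" where
  "digit m d h = nat (if d then int m - h else h + 1)"

fun odo_value :: "nat \<Rightarrow> bool list \<Rightarrow> int list \<Rightarrow> nat" where
  "odo_value m (d # ds) (h # hs) = digit m d h + (m + 1) * odo_value m ds hs"
| "odo_value m _ _ = 0"

definition valid_digit :: "nat \<Rightarrow> bool \<Rightarrow> int \<Rightarrow> bool" where
  "valid_digit m d h \<longleftrightarrow> (if d then 0 \<le> h \<and> h \<le> int m else - 1 \<le> h \<and> h < int m)"

definition block :: "nat \<Rightarrow> int \<Rightarrow> nat" where
  "block m i = (if 0 \<le> i \<and> i < int m then 1 else 0)"

lemma length_odo_step: "length (fst (odo_step ds ss)) = length ds"
  by (induction ds ss rule: odo_step.induct) (auto split: prod.split)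

lemma length_odo_step_acts: "length (fst (snd (odo_step ds ss))) = length ss"
  by (induction ds ss rule: odo_step.induct) (auto split: prod.split)

lemma odo_step_symbols: "(s, d) \<in> set (fst (snd (odo_step ds ss))) \<Longrightarrow> s \<in> set ss"
  by (induction ds ss rule: odo_step.induct) (auto split: prod.splits if_splits)

text \<open>This is subtraction of 1 with borrowing. A head on a blank has digit 0; reversing it and
  moving it one cell back makes its digit \<open>m\<close>, and the next digit is decremented. A
  carry out of the last digit thus means that all digits were 0.\<close>

lemma odo_step_correct:
  assumes "list_all2 (valid_digit m) ds hs"
    "odo_step ds (map (block m) hs) = (ds', as, c)"
  shows "\<exists>hs'. map2 act as (map (\<lambda>h. (block m, h)) hs) = map (\<lambda>h. (block m, h)) hs' \<and>
    length hs' = length hs \<and> (c \<longleftrightarrow> odo_value m ds hs = 0) \<and>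
    (\<not> c \<longrightarrow> list_all2 (valid_digit m) ds' hs' \<and> odo_value m ds hs = Suc (odo_value m ds' hs'))"
  using assms
proof (induction ds hs arbitrary: ds' as c rule: list_all2_induct)
  case Nil
  then show ?case by simp
next
  case (Cons d ds h hs)
  have holds: "map2 act (map (hold \<circ> block m) hs) (map (\<lambda>h. (block m, h)) hs) =
      map (\<lambda>h. (block m, h)) hs" for hs
    by (induction hs) auto
  show ?case
  proof (cases "block m h = 0")
    case False
    then have h: "0 \<le> h" "h < int m" by (auto simp: block_def split: if_splits)
    have eq: "ds' = d # ds" "as = (block m h, sweep d) # map (hold \<circ> block m) hs" "\<not> c"
      using Cons.prems False by auto
    have "valid_digit m d (h + displacement (sweep d))"
      "digit m d h = Suc (digit m d (h + displacement (sweep d)))"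
      using h by (auto simp: valid_digit_def sweep_def)
    then show ?thesis
      using eq Cons.hyps holds
      by (intro exI[of _ "(h + displacement (sweep d)) # hs"]) (auto simp del: digit.simps)
  next
    case True
    obtain es bs where o: "odo_step ds (map (block m) hs) = (es, bs, c)"
      and eq: "ds' = (\<not> d) # es" "as = (0, sweep (\<not> d)) # bs"
      using Cons.prems True by (auto split: prod.splits)
    obtain hs' where hs': "map2 act bs (map (\<lambda>h. (block m, h)) hs) = map (\<lambda>h. (block m, h)) hs'"
      "length hs' = length hs" "c \<longleftrightarrow> odo_value m ds hs = 0"
      "\<not> c \<longrightarrow> list_all2 (valid_digit m) es hs' \<and> odo_value m ds hs = Suc (odo_value m es hs')"
      using Cons.IH[OF o] by blast
    have "h < 0 \<or> h \<ge> int m" using True by (auto simp: block_def split: if_splits)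
    then have d: "digit m d h = 0" "valid_digit m (\<not> d) (h + displacement (sweep (\<not> d)))"
      "digit m (\<not> d) (h + displacement (sweep (\<not> d))) = m"
      using Cons.hyps(1) by (auto simp: valid_digit_def sweep_def split: if_splits)
    show ?thesis
      using eq hs' d True
      by (intro exI[of _ "(h + displacement (sweep (\<not> d))) # hs'"])
        (cases c, auto simp del: digit.simps simp: fun_upd_idem)
  qed
qed

section \<open>The counting machine\<close>

text \<open>
  Besides the four argument and result tapes, the machine has a unary counter \<open>y\<close>, \<open>k\<close>
  odometer tapes, and all tapes of \<open>M\<close> except the first two, whose role is played by the tapes of
  \<open>x\<close> and \<open>u\<close>: counting \<open>y\<close> off erases it, so that the head arrives at \<open>u\<close> on an otherwise blank
  tape. The state \<open>Add c\<close> adds 1, with carry \<open>c\<close>, to the output of \<open>M\<close> bit by bit; the counter holds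
  two marks in excess of \<open>length z\<close> because of the division by 4. The result is written from its
  last bit leftwards, which leaves the head at its beginning.
\<close>

datatype state = Start | Start2 | Copy | Rewind | Odo "bool list" bool | Sim nat bool
  | Add bool | Out

text \<open>Since \<open>M\<close> borrows the first two tapes, \<open>hd ms\<close> and
  \<open>ms ! 1\<close> are scanned on its third and fourth tape, that is, on its precision argument
  and its result. \<open>Start\<close> and \<open>Start2\<close> write the two excess marks of the
  counter and, leftwards, the precision 2 in unary. In \<open>Odo\<close>, the test
  \<open>u \<noteq> 0\<close> ends the count when the word is too short. The \<open>min\<close> in
  \<open>Sim\<close> keeps the state set closed on illegal symbols, where \<open>delta\<close> is
  arbitrary. A result without positive sign leads directly to the answer 0.\<close>

definition extract_delta :: "tm \<Rightarrow> nat \<Rightarrow> state \<Rightarrow> nat \<Rightarrow> nat \<Rightarrow> nat \<Rightarrow> nat \<Rightarrow> nat \<Rightarrow>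
    nat list \<Rightarrow> nat list \<Rightarrow> state option \<times> (nat \<times> move) list" where
  "extract_delta M k s x u b z y os ms = (case s of
     Start \<Rightarrow> (Some Start2,
       hold x # hold u # hold b # hold z # (1, Move_Right) # map hold os @ (2, Move_Left) # map hold (tl ms))
   | Start2 \<Rightarrow> (Some Copy,
       hold x # hold u # hold b # hold z # (1, Move_Right) # map hold os @ hold 2 # map hold (tl ms))
   | Copy \<Rightarrow> if x \<noteq> 0
       then (Some Copy, (x, Move_Right) # hold u # hold b # hold z # hold y #
         map (\<lambda>_. (1, Move_Right)) os @ map hold ms)
       else (Some Rewind, (x, Move_Left) # hold u # hold b # hold z # hold y #
         map (\<lambda>_. hold 1) os @ map hold ms)
   | Rewind \<Rightarrow> if x \<noteq> 0
       then (Some Rewind, (x, Move_Left) # hold u # hold b # hold z # hold y # map hold os @ map hold ms)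
       else (Some (Odo (replicate k False) False),
         (x, Move_Right) # hold u # hold b # hold z # hold y # map hold os @ map hold ms)
   | Odo ds seen \<Rightarrow> (case odo_step ds os of (ds', as, c) \<Rightarrow>
       (Some (if c then Sim 0 (seen \<or> u = 2) else Odo ds' (seen \<or> u = 2)),
         hold x # (0, Move_Right) # hold b # hold z #
           (if seen \<and> u \<noteq> 0 then (1, Move_Right) else hold y) # as @ map hold ms))
   | Sim q seen \<Rightarrow>
       if q < num_states M
       then (case delta M q (x # u # ms) of (q', as) \<Rightarrow>
         (Some (Sim (min q' (num_states M)) seen),
           as ! 0 # as ! 1 # hold b # hold z # hold y # map hold os @ drop 2 as))
       else if seen \<and> ms ! 1 = 1
       then (Some (Add True), hold x # hold u # hold b # hold z # (y, Move_Left) #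
         map hold os @ hold (hd ms) # (ms ! 1, Move_Right) # map hold (drop 2 ms))
       else (Some Out, hold x # hold u # hold b # (1, Move_Left) # hold y #
         map hold os @ map hold ms)
   | Add c \<Rightarrow>
       if y \<noteq> 0
       then (Some (Add (ms ! 1 = 2 \<and> c)), hold x # hold u # hold b # hold z # (y, Move_Left) #
         map hold os @ hold (hd ms) # (ms ! 1, if ms ! 1 = 0 then Stay else Move_Right) #
         map hold (drop 2 ms))
       else (Some Out, hold x # hold u # hold b #
         (if (ms ! 1 = 2) \<noteq> c then 2 else 1, Move_Left) # hold y # map hold os @ map hold ms)
   | Out \<Rightarrow>
       if b \<noteq> 0
       then (Some Out, hold x # hold u # (b, Move_Right) # (1, Move_Left) # hold y #
         map hold os @ map hold ms)
       else (None, hold x # hold u # hold b # hold 1 # hold y # map hold os @ map hold ms))"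

fun counter_delta :: "tm \<Rightarrow> nat \<Rightarrow> state transition" where
  "counter_delta M k s (x # u # b # z # y # ss) =
     extract_delta M k s x u b z y (take k ss) (drop k ss)"
| "counter_delta M k s _ = (None, [])"

definition counter_states :: "tm \<Rightarrow> nat \<Rightarrow> state set" where
  "counter_states M k = {Start, Start2, Copy, Rewind, Out} \<union> range Add \<union>
     (\<lambda>(ds, seen). Odo ds seen) ` ({ds. length ds = k} \<times> UNIV) \<union>
     (\<lambda>(q, seen). Sim q seen) ` ({..num_states M} \<times> UNIV)"

lemma finite_counter_states: "finite (counter_states M k)"
  by (auto simp: counter_states_def finite_length_eq)

lemma counter_delta_closed:
  assumes "s \<in> counter_states M k"
  shows "fst (counter_delta M k s ss) \<in> insert None (Some ` counter_states M k)"
proof (cases "(M, k, s, ss)" rule: counter_delta.cases)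
  case (1 M' k' s' x u b z y ss')
  have "length (fst (odo_step ds os)) = k" if "length ds = k" for ds os
    using that by (simp add: length_odo_step)
  then show ?thesis
    using 1 assms
    by (auto simp: counter_states_def extract_delta_def image_iff split: prod.split state.split)
      (metis fst_conv)+
qed auto

lemma counter_delta_wf:
  assumes "wf_tm M" "4 \<le> num_tapes M" "length ss = k + num_tapes M + 3"
    "\<forall>a\<in>set ss. a < num_symbols M"
  shows "length (snd (counter_delta M k s ss)) = k + num_tapes M + 3 \<and>
    (\<forall>(a, d)\<in>set (snd (counter_delta M k s ss)). a < num_symbols M)"
proof -
  obtain x u b z y ss' where ss: "ss = x # u # b # z # y # ss'"
  proof -
    have "Suc (Suc (Suc (Suc (Suc 0)))) \<le> length ss" using assms(2,3) by simp
    then show ?thesis using that by (auto simp: Suc_le_length_iff)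
  qed
  define os ms where "os = take k ss'" and "ms = drop k ss'"
  have len: "length os = k" "length ms = num_tapes M - 2"
    using assms(2,3) ss by (auto simp: os_def ms_def)
  have sym: "x < num_symbols M" "u < num_symbols M" "b < num_symbols M" "z < num_symbols M"
    "y < num_symbols M" "\<forall>a\<in>set os. a < num_symbols M" "\<forall>a\<in>set ms. a < num_symbols M"
    "3 \<le> num_symbols M"
    using assms(1,4) ss by (auto simp: os_def ms_def wf_tm_def dest: in_set_takeD in_set_dropD)
  obtain m0 m1 ms' where ms: "ms = m0 # m1 # ms'"
    using len(2) assms(2) by (cases ms; cases "tl ms") auto
  have "length (snd (extract_delta M k s x u b z y os ms)) = k + num_tapes M + 3 \<and>
    (\<forall>(a, d)\<in>set (snd (extract_delta M k s x u b z y os ms)). a < num_symbols M)"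
  proof (cases s)
    case (Odo ds seen)
    have "length (fst (snd (odo_step ds os))) = k"
      using len by (simp add: length_odo_step_acts)
    moreover have "\<forall>(a, d)\<in>set (fst (snd (odo_step ds os))). a < num_symbols M"
      using odo_step_symbols sym(6) by blast
    ultimately show ?thesis
      using sym len assms(2) by (auto simp: extract_delta_def Odo split: prod.split)
  next
    case (Sim q seen)
    show ?thesis
    proof (cases "q < num_states M")
      case True
      obtain q' as where d: "delta M q (x # u # ms) = (q', as)" by fastforce
      have "length (x # u # ms) = num_tapes M" "\<forall>s\<in>set (x # u # ms). s < num_symbols M"
        using len sym assms(2) by auto
      then have *: "length as = num_tapes M" "\<forall>(s, d)\<in>set as. s < num_symbols M"
        using assms(1)[unfolded wf_tm_def, THEN conjunct2, THEN spec, THEN spec, of q "x # u # ms"]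
          True d by auto
      obtain a0 a1 as' where as: "as = a0 # a1 # as'"
        using *(1) assms(2) by (cases as; cases "tl as") auto
      show ?thesis
        using True d * as sym len assms(2) by (auto simp: extract_delta_def Sim)
    qed (use sym len assms(2) ms in \<open>auto simp: extract_delta_def Sim\<close>)
  qed (use sym len assms(2) ms in \<open>auto simp: extract_delta_def\<close>)
  then show ?thesis by (simp add: ss os_def ms_def)
qed

section \<open>Runs of the counting machine\<close>

lemma funpow_trans:
  assumes "(f ^^ m) a = b" "(f ^^ n) b = c"
  shows "(f ^^ (m + n)) a = c"
  using assms by (simp add: add.commute[of m] funpow_add)

context
  fixes M :: tm and k :: nat and r :: "state option \<times> tape list \<Rightarrow> state option \<times> tape list"
  defines "r \<equiv> run_step (counter_delta M k)"
begin

lemma r_Some: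
  assumes "length Os = k"
  shows "r (Some s, X # U # B # Z # Y # Os @ Ms) =
    (case extract_delta M k s (scanned X) (scanned U) (scanned B) (scanned Z) (scanned Y)
        (map scanned Os) (map scanned Ms) of
      (s', acts) \<Rightarrow> (s', map2 act acts (X # U # B # Z # Y # Os @ Ms)))"
  using assms by (simp add: r_def)

lemma map2_act_hold_append:
  "map2 act (map (hold \<circ> scanned) Os @ as) (Os @ Ms) = Os @ map2 act as Ms"
  by (induction Os) auto

lemma block_upd: "(block m)(int m := Suc 0) = block (Suc m)"
  by (auto simp: block_def fun_eq_iff)

lemma run_start:
  assumes "length Os = k"
  shows "(r ^^ 2) (Some Start, X # U # B # Z # (block 0, 0) # Os @ (\<lambda>_. 0, 0) # Ms) =
    (Some Copy, X # U # B # Z # (block 2, 2) # Os @ ((\<lambda>_. 0)(0 := 2, -1 := 2), -1) # Ms)"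
proof -
  have "(block 0)(0 := Suc 0, 1 := Suc 0) = block 2"
    by (auto simp: block_def fun_eq_iff)
  then show ?thesis
    using assms
    by (simp add: numeral_2_eq_2 r_Some extract_delta_def map2_act_hold_append del: act.simps scanned_Pair)
      (simp add: numeral_2_eq_2)
qed

lemma run_copy:
  assumes c: "\<And>i. c i \<noteq> 0 \<longleftrightarrow> 0 \<le> i \<and> i < int n" and "i \<le> n"
  shows "(r ^^ i) (Some Copy, (c, 0) # U # B # Z # Y # replicate k (block 0, 0) @ Ms) =
    (Some Copy, (c, int i) # U # B # Z # Y # replicate k (block i, int i) @ Ms)"
  using assms(2)
proof (induction i)
  case (Suc i)
  have "map2 act (replicate k (Suc 0, Move_Right) @ map (hold \<circ> scanned) Ms) (replicate k (block i, int i) @ Ms)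
    = replicate k (block (Suc i), int (Suc i)) @ Ms"
    by (simp add: zip_replicate block_upd add.commute)
  then show ?case
    using Suc c[of "int i"]
    by (simp add: r_Some extract_delta_def map_replicate_const add.commute)
qed simp

text \<open>The last step adds one mark, so a block has \<open>n + 1\<close> cells and the odometer
  has base \<open>n + 2\<close>. The heads stop on the last cell, where a leftward digit has its
  maximal value \<open>n + 1\<close>.\<close>

lemma run_copy_rewind:
  assumes c: "\<And>i. c i \<noteq> 0 \<longleftrightarrow> 0 \<le> i \<and> i < int n"
  shows "(r ^^ Suc n) (Some Copy, (c, 0) # U # B # Z # Y # replicate k (block 0, 0) @ Ms) =
    (Some Rewind, (c, int n - 1) # U # B # Z # Y # replicate k (block (Suc n), int n) @ Ms)"
proof -
  have "map2 act (replicate k (hold (Suc 0)) @ map (hold \<circ> scanned) Ms) (replicate k (block n, int n) @ Ms)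
    = replicate k (block (Suc n), int n) @ Ms"
    by (simp add: zip_replicate block_upd add.commute)
  then show ?thesis
    using run_copy[OF c, of n U B Z Y Ms] c[of "int n"]
    by (simp add: r_Some extract_delta_def map_replicate_const fun_upd_idem)
qed

lemma run_rewind:
  assumes c: "\<And>i. c i \<noteq> 0 \<longleftrightarrow> 0 \<le> i \<and> i < int n" and "length Os = k" "i \<le> n"
  shows "(r ^^ i) (Some Rewind, (c, int n - 1) # U # B # Z # Y # Os @ Ms) =
    (Some Rewind, (c, int n - 1 - int i) # U # B # Z # Y # Os @ Ms)"
  using assms(3)
proof (induction i)
  case (Suc i)
  then show ?case
    using assms(2) c[of "int n - 1 - int i"]
    by (simp add: r_Some extract_delta_def map2_act_hold_append)
qed simp

lemma run_rewind_odo: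
  assumes c: "\<And>i. c i \<noteq> 0 \<longleftrightarrow> 0 \<le> i \<and> i < int n" and "length Os = k"
  shows "(r ^^ Suc n) (Some Rewind, (c, int n - 1) # U # B # Z # Y # Os @ Ms) =
    (Some (Odo (replicate k False) False), (c, 0) # U # B # Z # Y # Os @ Ms)"
  using run_rewind[OF c assms(2), of n U B Z Y Ms] assms(2) c[of "-1"]
  by (simp add: r_Some extract_delta_def map2_act_hold_append fun_upd_idem)

text \<open>The effect of one \<open>Odo\<close> step on the word, the counter and the flag. It does
  not depend on the odometer, which serves purely as a clock.\<close>

fun track :: "tape \<times> tape \<times> bool \<Rightarrow> tape \<times> tape \<times> bool" where
  "track (U, Y, seen) =
     (act (0, Move_Right) U,
      if seen \<and> scanned U \<noteq> 0 then act (1, Move_Right) Y else Y,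
      seen \<or> scanned U = 2)"

text \<open>Each step lowers the odometer by 1 and applies \<open>track\<close> once; the step that
  finds all digits 0 applies it too, hence the \<open>Suc\<close>. The final odometer tapes are left
  unspecified, since no later state depends on them.\<close>

lemma run_odo:
  assumes "list_all2 (valid_digit m) ds hs" "length hs = k"
    "(track ^^ Suc (odo_value m ds hs)) (U, Y, seen) = (U', Y', seen')"
  shows "\<exists>Os'. length Os' = k \<and>
    (r ^^ Suc (odo_value m ds hs))
      (Some (Odo ds seen), X # U # B # Z # Y # map (\<lambda>h. (block m, h)) hs @ Ms) =
    (Some (Sim 0 seen'), X # U' # B # Z # Y' # Os' @ Ms)"
  using assms
proof (induction "odo_value m ds hs" arbitrary: ds hs U Y seen)
  case 0
  obtain ds' as c where o: "odo_step ds (map (block m) hs) = (ds', as, c)" using prod_cases3 by blast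
  obtain hs' where hs': "map2 act as (map (\<lambda>h. (block m, h)) hs) = map (\<lambda>h. (block m, h)) hs'"
      "length hs' = length hs" "c"
    using odo_step_correct[OF 0(2) o] 0(1) by auto
  have las: "length as = k"
    using length_odo_step_acts[of ds "map (block m) hs"] o 0(3) by simp
  have "map2 act (as @ map (hold \<circ> scanned) Ms) (map (\<lambda>h. (block m, h)) hs @ Ms) =
      map (\<lambda>h. (block m, h)) hs' @ Ms"
    using hs'(1) las 0(3) by simp
  then show ?case
    using 0 o hs'
    by (intro exI[of _ "map (\<lambda>h. (block m, h)) hs'"])
      (auto simp: r_Some extract_delta_def comp_def simp flip: 0(1))
next
  case (Suc v)
  obtain ds' as c where o: "odo_step ds (map (block m) hs) = (ds', as, c)" using prod_cases3 by blast
  obtain hs' where hs': "map2 act as (map (\<lambda>h. (block m, h)) hs) = map (\<lambda>h. (block m, h)) hs'"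
      "length hs' = length hs" "\<not> c" "list_all2 (valid_digit m) ds' hs'" "v = odo_value m ds' hs'"
    using odo_step_correct[OF Suc(3) o] Suc(2) by auto
  have las: "length as = k"
    using length_odo_step_acts[of ds "map (block m) hs"] o Suc(4) by simp
  have m: "map2 act (as @ map (hold \<circ> scanned) Ms) (map (\<lambda>h. (block m, h)) hs @ Ms) =
      map (\<lambda>h. (block m, h)) hs' @ Ms"
    using hs'(1) las Suc(4) by simp
  obtain U1 Y1 seen1 where t: "track (U, Y, seen) = (U1, Y1, seen1)" using prod_cases3 by blast
  have r1: "r (Some (Odo ds seen), X # U # B # Z # Y # map (\<lambda>h. (block m, h)) hs @ Ms) =
      (Some (Odo ds' seen1), X # U1 # B # Z # Y1 # map (\<lambda>h. (block m, h)) hs' @ Ms)"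
    using o hs'(3) m Suc(4) t by (auto simp: r_Some extract_delta_def comp_def)
  have "(track ^^ Suc (odo_value m ds' hs')) (U1, Y1, seen1) = (U', Y', seen')"
    using Suc(5) t hs'(5) unfolding Suc(2)[symmetric] by (simp add: funpow_swap1 del: track.simps)
  moreover have "length hs' = k" using hs'(2) Suc(4) by simp
  ultimately obtain Os' where "length Os' = k"
    "(r ^^ Suc v) (Some (Odo ds' seen1), X # U1 # B # Z # Y1 # map (\<lambda>h. (block m, h)) hs' @ Ms) =
      (Some (Sim 0 seen'), X # U' # B # Z # Y' # Os' @ Ms)"
    using Suc(1)[OF hs'(5,4)] unfolding hs'(5) by blast
  then show ?case
    unfolding Suc(2)[symmetric] funpow_Suc_right[of "Suc v"] comp_def r1 by blast
qed

text \<open>The first \<open>True\<close> only raises the flag and is not counted itself, so the new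
  marks number \<open>length z - 1\<close>; truncated subtraction makes this 0 while no
  \<open>True\<close> has been met.\<close>

lemma track_input_tape:
  "(track ^^ j) (input_tape u, (block 2, 2), False) =
    (let z = dropWhile Not (take j u); w = 2 + (length z - 1)
     in ((\<lambda>i. if i < int j then 0 else fst (input_tape u) i, int j), (block w, int w), z \<noteq> []))"
proof (induction j)
  case 0
  then show ?case by (auto simp: input_tape_def fun_eq_iff numeral_2_eq_2)
next
  case (Suc j)
  define z where "z = dropWhile Not (take j u)"
  define s where "s = fst (input_tape u) (int j)"
  define E where "E j = (\<lambda>i. if i < int j then 0 else fst (input_tape u) i)" for j
  have E: "act (0, Move_Right) (E j, int j) = (E (Suc j), int (Suc j))"
    by (auto simp: E_def fun_eq_iff)
  have w: "act (1, Move_Right) (block w, int w) = (block (Suc w), int (Suc w))" for w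
    by (simp add: block_upd)
  define w where "w = 2 + (length z - 1)"
  have "(track ^^ Suc j) (input_tape u, (block 2, 2), False) =
      track ((E j, int j), (block w, int w), z \<noteq> [])"
    using Suc by (simp add: Let_def z_def E_def w_def)
  also have "\<dots> = ((E (Suc j), int (Suc j)),
      (if z \<noteq> [] \<and> s \<noteq> 0 then (block (Suc w), int (Suc w)) else (block w, int w)), z \<noteq> [] \<or> s = 2)"
    by (simp only: track.simps E w scanned_Pair) (simp add: E_def s_def)
  finally have step: "(track ^^ Suc j) (input_tape u, (block 2, 2), False) = \<dots>" .
  show ?case
  proof (cases "j < length u")
    case True
    then have "dropWhile Not (take (Suc j) u) =
        (if z = [] then dropWhile Not [u ! j] else z @ [u ! j])"
      unfolding z_def take_Suc_conv_app_nth[OF True] dropWhile_append by auto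
    moreover have "s = bit_symbol (u ! j)"
      using True by (simp add: s_def input_tape_def)
    moreover have "Suc (length z - 1) = length z" if "z \<noteq> []"
      using that by (cases z) auto
    ultimately show ?thesis
      unfolding step by (simp add: Let_def E_def[of "Suc j"] w_def numeral_2_eq_2)
  next
    case False
    then have "take (Suc j) u = take j u" by simp
    moreover have "s = 0"
      using False by (simp add: s_def input_tape_def)
    ultimately show ?thesis
      unfolding step by (simp add: Let_def z_def E_def[of "Suc j"] w_def)
  qed
qed

text \<open>The simulation is left once \<open>M\<close> has halted, so the runs are compared only
  up to the first halting time. On well-formed configurations the \<open>min\<close> in
  \<open>Sim\<close> is the identity.\<close>

lemma run_sim:
  assumes "wf_tm M" "4 \<le> num_tapes M" "wf_config M (q, X # U # Ms)" "length Os = k"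
    "\<And>i. i < j \<Longrightarrow> fst ((step M ^^ i) (q, X # U # Ms)) < num_states M"
  shows "\<exists>q' X' U' Ms'. (step M ^^ j) (q, X # U # Ms) = (q', X' # U' # Ms') \<and>
    (r ^^ j) (Some (Sim q seen), X # U # B # Z # Y # Os @ Ms) =
      (Some (Sim q' seen), X' # U' # B # Z # Y # Os @ Ms')"
  using assms(5)
proof (induction j)
  case (Suc j)
  then obtain q1 X1 U1 Ms1 where IH: "(step M ^^ j) (q, X # U # Ms) = (q1, X1 # U1 # Ms1)"
    "(r ^^ j) (Some (Sim q seen), X # U # B # Z # Y # Os @ Ms) =
      (Some (Sim q1 seen), X1 # U1 # B # Z # Y # Os @ Ms1)" by force
  have q1: "q1 < num_states M" using Suc(2)[of j] IH(1) by simp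
  have wf: "wf_config M (q1, X1 # U1 # Ms1)"
    using wf_config_funpow_step[OF assms(1,3), of j] IH(1) by simp
  obtain q' as where d: "delta M q1 (map scanned (X1 # U1 # Ms1)) = (q', as)" by fastforce
  note * = wf_config_delta[OF assms(1) wf q1 d]
  obtain a0 a1 as' where as: "as = a0 # a1 # as'"
    using *(2) assms(2) by (cases as; cases "tl as") auto
  have min: "min q' (num_states M) = q'" using *(1) by simp
  have "step M (q1, X1 # U1 # Ms1) = (q', act a0 X1 # act a1 U1 # map2 act as' Ms1)"
    using q1 d as by simp
  moreover have "r (Some (Sim q1 seen), X1 # U1 # B # Z # Y # Os @ Ms1) =
      (Some (Sim q' seen), act a0 X1 # act a1 U1 # B # Z # Y # Os @ map2 act as' Ms1)"
    using q1 d as min assms(4) by (simp add: r_Some extract_delta_def map2_act_hold_append)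
  ultimately show ?case using IH by simp
qed simp

text \<open>Behind the last bit the head stays on the blank, which reads as 0. This matches
  \<open>tl [] = []\<close> and the tests \<open>bs \<noteq> []\<close> in
  \<open>carry_bit\<close>.\<close>

lemma tape_output_advance:
  assumes "tape_output (c, h) bs"
  shows "tape_output (c, h + displacement (if c h = 0 then Stay else Move_Right)) (tl bs)"
    "c h = 2 \<longleftrightarrow> bs \<noteq> [] \<and> hd bs" "c h = 1 \<longleftrightarrow> bs \<noteq> [] \<and> \<not> hd bs"
proof -
  show "tape_output (c, h + displacement (if c h = 0 then Stay else Move_Right)) (tl bs)"
  proof (cases bs)
    case (Cons b bs')
    then have "c h = bit_symbol b" using assms by (auto simp: tape_output_def)
    then have "c h \<noteq> 0" by simp
    moreover have "c (h + 1 + int i) = bit_symbol (bs' ! i)" if "i < length bs'" for i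
    proof -
      have "c (h + int (Suc i)) = bit_symbol (bs ! Suc i)"
        using assms that Cons unfolding tape_output_def by (metis Suc_mono fst_conv length_Cons snd_conv)
      then show ?thesis using Cons by (simp add: algebra_simps)
    qed
    ultimately show ?thesis
      using assms Cons by (auto simp: tape_output_def algebra_simps)
  qed (use assms in \<open>auto simp: tape_output_def\<close>)
  show "c h = 2 \<longleftrightarrow> bs \<noteq> [] \<and> hd bs" "c h = 1 \<longleftrightarrow> bs \<noteq> [] \<and> \<not> hd bs"
    using assms by (cases bs; cases "hd bs"; force simp: tape_output_def)+
qed

text \<open>Each of the \<open>w\<close> marks consumes one bit of the output while the carry is
  updated; the blank at cell -1 of the counter signals that the wanted bit has been reached.\<close>

lemma run_add:
  assumes "tape_output m1 bs" "\<And>i. 0 \<le> i \<Longrightarrow> i < int w \<Longrightarrow> c i \<noteq> 0" "c (-1) = 0" "length Os = k"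
  shows "\<exists>Y' m1'. (r ^^ Suc w)
      (Some (Add carry), X # U # B # Z # (c, int w - 1) # Os @ m0 # m1 # Ms) =
    (Some Out, X # U # B # act (if carry_bit bs w carry then 2 else 1, Move_Left) Z # Y' #
      Os @ m0 # m1' # Ms)"
  using assms(1,2)
proof (induction w arbitrary: bs m1 carry)
  case 0
  obtain d h where m1: "m1 = (d, h)" by fastforce
  show ?case
    using 0 m1 tape_output_advance[of d h bs] assms(3,4)
    by (auto simp: r_Some extract_delta_def map2_act_hold_append fun_upd_idem)
next
  case (Suc w)
  obtain d h where m1: "m1 = (d, h)" by fastforce
  define m2 where "m2 = (d, h + displacement (if d h = 0 then Stay else Move_Right))"
  note adv = tape_output_advance[of d h bs, folded m2_def]
  have 1: "r (Some (Add carry), X # U # B # Z # (c, int (Suc w) - 1) # Os @ m0 # m1 # Ms) =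
      (Some (Add ((bs \<noteq> [] \<and> hd bs) \<and> carry)), X # U # B # Z # (c, int w - 1) # Os @ m0 # m2 # Ms)"
    using Suc(2) Suc(3)[of "int w"] m1 adv(2) assms(4)
    by (auto simp: r_Some extract_delta_def map2_act_hold_append m2_def)
  have "tape_output m2 (tl bs)" using adv(1) Suc(2) m1 by simp
  from Suc(1)[OF this, of "(bs \<noteq> [] \<and> hd bs) \<and> carry"] Suc(3)
  show ?case
    using 1 by (auto simp: funpow_Suc_right simp del: funpow.simps)
qed

text \<open>The result under construction: the top bit \<open>s\<close> at cell 0, \<open>j\<close>
  zeros to its left, and the head on the next free cell, which finally receives the sign.\<close>

definition out_tape :: "nat \<Rightarrow> nat \<Rightarrow> tape" where
  "out_tape s j = ((\<lambda>i. if i = 0 then s else if - int j \<le> i \<and> i < 0 then 1 else 0), - 1 - int j)"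

lemma run_out:
  assumes c: "\<And>i. c i \<noteq> 0 \<longleftrightarrow> 0 \<le> i \<and> i < int n" and "length Os = k" "i \<le> n"
  shows "(r ^^ i) (Some Out, X # U # (c, 0) # out_tape s 0 # Y # Os @ Ms) =
    (Some Out, X # U # (c, int i) # out_tape s i # Y # Os @ Ms)"
  using assms(3)
proof (induction i)
  case (Suc i)
  have "act (Suc 0, Move_Left) (out_tape s i) = out_tape s (Suc i)"
    by (auto simp: out_tape_def fun_eq_iff)
  then show ?case
    using Suc assms(2) c[of "int i"]
    by (simp add: r_Some extract_delta_def map2_act_hold_append add.commute)
qed simp

lemma run_out_halt:
  assumes c: "\<And>i. c i \<noteq> 0 \<longleftrightarrow> 0 \<le> i \<and> i < int n" and "length Os = k"
  shows "\<exists>Z B'. tape_output Z (False # replicate n False @ [b]) \<and>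
    (r ^^ Suc n) (Some Out, X # U # (c, 0) # out_tape (bit_symbol b) 0 # Y # Os @ Ms) =
    (None, X # U # B' # Z # Y # Os @ Ms)"
proof -
  define Z where "Z = act (hold 1) (out_tape (bit_symbol b) n)"
  have "tape_output Z (False # replicate n False @ [b])"
    by (auto simp: Z_def out_tape_def tape_output_def nth_Cons nth_append split: nat.split)
  moreover have "(r ^^ Suc n) (Some Out, X # U # (c, 0) # out_tape (bit_symbol b) 0 # Y # Os @ Ms) =
      (None, X # U # (c, int n) # Z # Y # Os @ Ms)"
    using run_out[OF c assms(2), of n X U "bit_symbol b" Y Ms] c[of "int n"] assms(2)
    by (simp add: r_Some extract_delta_def map2_act_hold_append Z_def fun_upd_idem del: act.simps)
      (simp add: fun_upd_idem)
  ultimately show ?thesis by blast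
qed

end

lemma input_tape_Nil: "input_tape [] = (\<lambda>_. 0, 0)"
  by (simp add: input_tape_def fun_eq_iff)

lemma view_after_track:
  "view ((\<lambda>i. if i < int j then 0 else fst (input_tape u) i), int j) = view (input_tape (drop j u))"
proof
  show "view ((\<lambda>i. if i < int j then 0 else fst (input_tape u) i), int j) i =
      view (input_tape (drop j u)) i" for i
    by (auto simp: view_def input_tape_def nat_add_distrib add.commute less_diff_conv)
qed

lemma view_two: "view ((\<lambda>_. 0)(0 := 2, -1 := 2), -1) = view (input_tape [True, True])"
  by (auto simp: view_def input_tape_def fun_eq_iff nth_Cons split: nat.split)

lemma wf_config_view_cong:
  assumes "map view tps = map view tps'" "wf_config M (q, tps)"
  shows "wf_config M (q, tps')"
proof -
  have *: "(\<forall>i. fst tp i < G) \<longleftrightarrow> (\<forall>i. view tp i < G)" for tp G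
    unfolding view_def by (metis add_diff_cancel_left' diff_add_eq)
  have **: "(\<forall>tp\<in>set tps. \<forall>i. fst tp i < G) \<longleftrightarrow> (\<forall>f\<in>set (map view tps). \<forall>i. f i < G)" for tps G
    by (simp add: *)
  show ?thesis
    using assms map_eq_imp_length_eq[OF assms(1)]
    unfolding wf_config_def fst_conv snd_conv ** by simp
qed

text \<open>A time bound only says that \<open>M\<close> has halted by time \<open>t\<close>,
  whereas the simulation ends at the first halting time. The tapes agree because a halted
  configuration is fixed.\<close>

lemma first_halting_time:
  assumes "wf_tm M" "wf_config M cfg" "(step M ^^ t) cfg = (num_states M, tps)"
  obtains j where "j \<le> t" "(step M ^^ j) cfg = (num_states M, tps)"
    "\<And>i. i < j \<Longrightarrow> fst ((step M ^^ i) cfg) < num_states M"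
proof -
  define j where "j = (LEAST j. fst ((step M ^^ j) cfg) = num_states M)"
  have j: "fst ((step M ^^ j) cfg) = num_states M"
    unfolding j_def by (rule LeastI[of _ t]) (simp add: assms(3))
  have "j \<le> t" unfolding j_def by (rule Least_le) (simp add: assms(3))
  obtain tps' where j': "(step M ^^ j) cfg = (num_states M, tps')"
    using j by (metis prod.collapse)
  have "(step M ^^ (j + (t - j))) cfg = (num_states M, tps')"
    by (rule funpow_trans[OF j']) (rule funpow_step_halted)
  then have "tps' = tps" using assms(3) \<open>j \<le> t\<close> by simp
  moreover have "fst ((step M ^^ i) cfg) < num_states M" if "i < j" for i
    using not_less_Least[OF that[unfolded j_def]] wf_config_funpow_step[OF assms(1,2), of i]
    by (simp add: wf_config_def)
  ultimately show ?thesis using that j' \<open>j \<le> t\<close> by blast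
qed

definition counter_tapes :: "tm \<Rightarrow> nat \<Rightarrow> bool list \<Rightarrow> bool list \<Rightarrow> nat \<Rightarrow> tape list" where
  "counter_tapes M k x u b = input_tape x # input_tape u # input_tape (replicate b True) #
     replicate (k + num_tapes M) (input_tape [])"

lemma input_tape_nonzero_iff: "fst (input_tape xs) i \<noteq> 0 \<longleftrightarrow> 0 \<le> i \<and> i < int (length xs)"
  by (simp add: input_tape_def)

lemma counter_run_until_sim:
  fixes M k
  defines "r \<equiv> run_step (counter_delta M k)"
  assumes "4 \<le> num_tapes M" and q: "q = (length x + 2) ^ k"
    and z: "z = dropWhile Not (take q u)" and w: "w = 2 + (length z - 1)"
  obtains Os where "length Os = k"
    "(r ^^ (2 + Suc (length x) + Suc (length x) + q)) (Some Start, counter_tapes M k x u b) =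
      (Some (Sim 0 (z \<noteq> [])), input_tape x #
        ((\<lambda>i. if i < int q then 0 else fst (input_tape u) i), int q) #
        input_tape (replicate b True) # (\<lambda>_. 0, 0) # (block w, int w) # Os @
        ((\<lambda>_. 0)(0 := 2, -1 := 2), -1) # replicate (num_tapes M - 3) (\<lambda>_. 0, 0))"
proof -
  define n where "n = length x"
  define X where "X = fst (input_tape x)"
  define U where "U = input_tape u"
  define B where "B = input_tape (replicate b True)"
  define Ms where "Ms = ((\<lambda>_. 0)(0 := 2, -1 := 2), -1) # replicate (num_tapes M - 3) ((\<lambda>_. 0, 0) :: tape)"
  have X: "X i \<noteq> 0 \<longleftrightarrow> 0 \<le> i \<and> i < int n" for i
    unfolding X_def n_def by (rule input_tape_nonzero_iff)
  have block0: "block 0 = (\<lambda>_. 0)" by (simp add: block_def fun_eq_iff)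
  have "k + num_tapes M = Suc (Suc (k + Suc (num_tapes M - 3)))" using assms(2) by simp
  then have tapes: "counter_tapes M k x u b = (X, 0) # U # B # (\<lambda>_. 0, 0) # (block 0, 0) #
      replicate k (block 0, 0) @ (\<lambda>_. 0, 0) # replicate (num_tapes M - 3) (\<lambda>_. 0, 0)"
    unfolding counter_tapes_def by (simp only: replicate_Suc replicate_add input_tape_Nil block0)
      (simp add: X_def U_def B_def input_tape_def)
  have 1: "(r ^^ 2) (Some Start, counter_tapes M k x u b) =
    (Some Copy, (X, 0) # U # B # (\<lambda>_. 0, 0) # (block 2, 2) # replicate k (block 0, 0) @ Ms)"
    unfolding tapes Ms_def r_def by (rule run_start) simp
  have 2: "(r ^^ Suc n) (Some Copy, (X, 0) # U # B # (\<lambda>_. 0, 0) # (block 2, 2) # replicate k (block 0, 0) @ Ms) =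
    (Some Rewind, (X, int n - 1) # U # B # (\<lambda>_. 0, 0) # (block 2, 2) # replicate k (block (Suc n), int n) @ Ms)"
    unfolding r_def by (rule run_copy_rewind[OF X])
  have 3: "(r ^^ Suc n) (Some Rewind, (X, int n - 1) # U # B # (\<lambda>_. 0, 0) # (block 2, 2) #
      replicate k (block (Suc n), int n) @ Ms) =
    (Some (Odo (replicate k False) False), (X, 0) # U # B # (\<lambda>_. 0, 0) # (block 2, 2) #
      replicate k (block (Suc n), int n) @ Ms)"
    unfolding r_def by (rule run_rewind_odo[OF X]) simp
  define ds hs where "ds = replicate k False" and "hs = replicate k (int n)"
  have valid: "list_all2 (valid_digit (Suc n)) ds hs"
    by (simp add: ds_def hs_def list_all2_conv_all_nth valid_digit_def)
  \<comment> \<open>All digits are maximal, so the odometer shows \<open>(n + 2) ^ k - 1\<close>;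
    the step that produces the final carry brings the count to exactly \<open>q\<close>.\<close>
  have "odo_value (Suc n) (replicate j False) (replicate j (int n)) + 1 = (n + 2) ^ j" for j
  proof (induction j)
    case (Suc j)
    have "nat (int n + 1) = n + 1" by simp
    then show ?case by (simp only: power_Suc Suc[symmetric]) (simp add: algebra_simps)
  qed simp
  then have odo_start: "Suc (odo_value (Suc n) ds hs) = q"
    by (simp add: ds_def hs_def q n_def)
  have "(track ^^ Suc (odo_value (Suc n) ds hs)) (U, (block 2, 2), False) =
    (((\<lambda>i. if i < int q then 0 else fst (input_tape u) i), int q), (block w, int w), z \<noteq> [])"
    using track_input_tape[of q u] unfolding odo_start U_def z w by (simp only: Let_def)
  moreover have "length hs = k" by (simp add: hs_def)
  ultimately obtain Os where Os: "length Os = k" and 4: "(r ^^ q)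
      (Some (Odo ds False), (X, 0) # U # B # (\<lambda>_. 0, 0) # (block 2, 2) #
        map (\<lambda>h. (block (Suc n), h)) hs @ Ms) =
      (Some (Sim 0 (z \<noteq> [])), (X, 0) # ((\<lambda>i. if i < int q then 0 else fst (input_tape u) i), int q) #
        B # (\<lambda>_. 0, 0) # (block w, int w) # Os @ Ms)"
    using run_odo[OF valid, where M = M and X = "(X, 0)" and B = B and Z = "(\<lambda>_. 0, 0)" and Ms = Ms]
    unfolding odo_start r_def by blast
  have "map (\<lambda>h. (block (Suc n), h)) hs = replicate k (block (Suc n), int n)"
    by (simp add: hs_def)
  then have "(r ^^ (2 + Suc n + Suc n + q)) (Some Start, counter_tapes M k x u b) =
      (Some (Sim 0 (z \<noteq> [])), (X, 0) # ((\<lambda>i. if i < int q then 0 else fst (input_tape u) i), int q) #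
        B # (\<lambda>_. 0, 0) # (block w, int w) # Os @ Ms)"
    using 4 unfolding ds_def by (intro funpow_trans[OF funpow_trans[OF funpow_trans[OF 1 2] 3]]) simp
  moreover have "(X, 0) = input_tape x" by (simp add: X_def input_tape_def)
  ultimately show ?thesis using that Os by (simp add: n_def B_def Ms_def)
qed

text \<open>Bit \<open>m\<close> of the approximation plus 1. A word that does not start with a
  positive sign denotes a number that is at most 0, for which the weight is 0 and no bit is
  set.\<close>

definition extracted :: "nat \<Rightarrow> bool list \<Rightarrow> bool" where
  "extracted m ys \<longleftrightarrow> (\<exists>bs. ys = False # bs \<and> carry_bit bs m True)"

lemma counter_run:
  assumes wf: "wf_tm M" and K: "4 \<le> num_tapes M" and q: "q = (length x + 2) ^ k"
    and z: "z = dropWhile Not (take q u)"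
    and out: "outputs_within M [x, drop q u, [True, True]] t ys"
  shows "\<exists>t' tps. t' \<le> 2 * length x + 2 * q + t + b + 10 \<and>
    (run_step (counter_delta M k) ^^ t') (Some Start, counter_tapes M k x u b) = (None, tps) \<and>
    tape_output (tps ! 3) (False # replicate b False @ [z \<noteq> [] \<and> extracted (length z + 1) ys])"
proof -
  define r where "r = run_step (counter_delta M k)"
  define w where "w = 2 + (length z - 1)"
  define U where "U = ((\<lambda>i. if i < int q then 0 else fst (input_tape u) i), int q)"
  define Mb where "Mb = (((\<lambda>_. 0)(0 := 2, -1 := 2), -1) :: tape)"
  define Ms where "Ms = Mb # replicate (num_tapes M - 3) ((\<lambda>_. 0, 0) :: tape)"
  define Z where "Z = ((\<lambda>_. 0, 0) :: tape)"
  obtain B where B: "input_tape (replicate b True) = (B, 0)" and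
    B_iff: "\<And>i. B i \<noteq> 0 \<longleftrightarrow> 0 \<le> i \<and> i < int b"
    using input_tape_nonzero_iff[of "replicate b True"] by (simp add: input_tape_def)
  obtain Os where Os: "length Os = k" and
    1: "(r ^^ (2 + Suc (length x) + Suc (length x) + q)) (Some Start, counter_tapes M k x u b) =
      (Some (Sim 0 (z \<noteq> [])), input_tape x # U # (B, 0) # Z # (block w, int w) # Os @ Ms)"
    using counter_run_until_sim[OF K q z w_def, of b] unfolding r_def U_def Ms_def Mb_def Z_def B
    by blast
  \<comment> \<open>The tapes of the simulated \<open>M\<close> equal its initial tapes only up to
    translation: the second head stands at cell \<open>q\<close>, the third at cell -1.\<close>
  have views: "map view (input_tape x # U # Ms) =
      map view (snd (initial_config M [x, drop q u, [True, True]]))"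
    unfolding U_def Ms_def Mb_def
    by (simp add: initial_config_def view_after_track view_two input_tape_Nil numeral_3_eq_3)
  have "wf_config M (initial_config M [x, drop q u, [True, True]])"
    using wf K by (intro wf_config_initial) auto
  then have wfc: "wf_config M (0, input_tape x # U # Ms)"
    using wf_config_view_cong[OF views[symmetric]] by (simp add: initial_config_def)
  have cong: "fst ((step M ^^ t) (0, input_tape x # U # Ms)) =
      fst ((step M ^^ t) (initial_config M [x, drop q u, [True, True]]))"
    "map view (snd ((step M ^^ t) (0, input_tape x # U # Ms))) =
      map view (snd ((step M ^^ t) (initial_config M [x, drop q u, [True, True]])))"
    using funpow_step_view_cong[OF views, of t M 0] by (simp_all add: initial_config_def)
  obtain tps0 where halt0: "(step M ^^ t) (0, input_tape x # U # Ms) = (num_states M, tps0)"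
    using cong(1) out by (auto simp: outputs_within_def split: prod.splits) (metis prod.collapse)
  obtain j where j: "j \<le> t" "(step M ^^ j) (0, input_tape x # U # Ms) = (num_states M, tps0)"
    "\<And>i. i < j \<Longrightarrow> fst ((step M ^^ i) (0, input_tape x # U # Ms)) < num_states M"
    using first_halting_time[OF wf wfc halt0] by blast
  obtain X' U' Ms' where tps0: "tps0 = X' # U' # Ms'" and
    2: "(r ^^ j) (Some (Sim 0 (z \<noteq> [])), input_tape x # U # (B, 0) # Z # (block w, int w) # Os @ Ms) =
      (Some (Sim (num_states M) (z \<noteq> [])), X' # U' # (B, 0) # Z # (block w, int w) # Os @ Ms')"
    using run_sim[OF wf K wfc Os j(3), where seen = "z \<noteq> []" and B = "(B, 0)" and Z = Z and
        Y = "(block w, int w)"] j(2)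
    unfolding r_def by fastforce
  have "wf_config M (num_states M, tps0)"
    using wf_config_funpow_step[OF wf wfc, of j] j(2) by simp
  then have len: "length tps0 = num_tapes M" by (simp add: wf_config_def)
  obtain m0 m1 Ms'' where Ms': "Ms' = m0 # m1 # Ms''"
    using len K tps0 by (cases Ms'; cases "tl Ms'") auto
  have m1: "tape_output m1 ys"
  proof -
    obtain tpsM where e: "(step M ^^ t) (initial_config M [x, drop q u, [True, True]]) = (num_states M, tpsM)"
      "tape_output (tpsM ! 3) ys"
      using out by (auto simp: outputs_within_def numeral_3_eq_3 split: prod.splits)
    have v: "map view tps0 = map view tpsM" using cong(2) e(1) halt0 by simp
    then have "length tpsM = length tps0" by (rule map_eq_imp_length_eq[symmetric])
    then have "map view tps0 ! 3 = view (tps0 ! 3)" "map view tpsM ! 3 = view (tpsM ! 3)"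
      using len K by auto
    then have "view (tps0 ! 3) = view (tpsM ! 3)" using v by simp
    then show ?thesis using e(2) by (simp add: tape_output_view tps0 Ms')
  qed
  obtain d h where dh: "m1 = (d, h)" by fastforce
  note adv = tape_output_advance[OF m1[unfolded dh]]
  let ?res = "z \<noteq> [] \<and> extracted (length z + 1) ys"
  have out0: "act (bit_symbol c, Move_Left) Z = out_tape (bit_symbol c) 0" for c
    by (auto simp: Z_def out_tape_def fun_eq_iff)
  have 3: "\<exists>l Y' Ms'''. l \<le> q + 4 \<and>
    (r ^^ l) (Some (Sim (num_states M) (z \<noteq> [])), X' # U' # (B, 0) # Z # (block w, int w) # Os @ Ms') =
      (Some Out, X' # U' # (B, 0) # out_tape (bit_symbol ?res) 0 # Y' # Os @ Ms''')"
  \<comment> \<open>Symbol 1 encodes \<open>False\<close>, so \<open>d h = 1\<close> says that the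
    output of \<open>M\<close> begins with a positive sign.\<close>
  proof (cases "z \<noteq> [] \<and> d h = 1")
    case True
    then obtain bs where bs: "ys = False # bs" using adv(3) by (cases ys) auto
    have m2: "tape_output (d, h + 1) bs" using adv(1) True bs by simp
    have w: "w = length z + 1" using True by (cases z) (auto simp: w_def)
    have "length z \<le> q"
      unfolding z using length_dropWhile_le[of Not "take q u"] by simp
    then have w_le: "w \<le> q + 1" using w by simp
    have add1: "(r ^^ 1) (Some (Sim (num_states M) (z \<noteq> [])), X' # U' # (B, 0) # Z # (block w, int w) # Os @ Ms') =
      (Some (Add True), X' # U' # (B, 0) # Z # (block w, int w - 1) # Os @ m0 # (d, h + 1) # Ms'')"
      using True Os
      by (simp add: r_def r_Some Ms' dh extract_delta_def map2_act_hold_append fun_upd_idem)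
    obtain Y' m1' where add2:
      "(r ^^ Suc w) (Some (Add True), X' # U' # (B, 0) # Z # (block w, int w - 1) # Os @ m0 # (d, h + 1) # Ms'') =
        (Some Out, X' # U' # (B, 0) # act (if carry_bit bs w True then 2 else 1, Move_Left) Z # Y' #
          Os @ m0 # m1' # Ms'')"
      using run_add[OF m2, where w = w and c = "block w" and Os = Os and k = k and M = M and
          carry = True and X = "X'" and U = "U'" and B = "(B, 0)" and Z = Z and ?m0.0 = m0 and Ms = "Ms''"] Os
      unfolding r_def by (auto simp: block_def)
    have res: "(if carry_bit bs w True then 2 else 1) = bit_symbol ?res"
      using True w bs by (simp add: extracted_def)
    have "(r ^^ (1 + Suc w)) (Some (Sim (num_states M) (z \<noteq> [])), X' # U' # (B, 0) # Z # (block w, int w) # Os @ Ms') =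
        (Some Out, X' # U' # (B, 0) # out_tape (bit_symbol ?res) 0 # Y' # Os @ m0 # m1' # Ms'')"
      using funpow_trans[OF add1 add2] unfolding res out0 .
    moreover have "1 + Suc w \<le> q + 4" using w_le by simp
    ultimately show ?thesis by blast
  next
    case False
    then have res: "?res = False" using adv(3) by (auto simp: extracted_def)
    have "(r ^^ 1) (Some (Sim (num_states M) (z \<noteq> [])), X' # U' # (B, 0) # Z # (block w, int w) # Os @ Ms') =
      (Some Out, X' # U' # (B, 0) # act (bit_symbol False, Move_Left) Z # (block w, int w) # Os @ Ms')"
      using False Os
      by (auto simp: r_def r_Some Ms' dh extract_delta_def map2_act_hold_append fun_upd_idem)
    then have "(r ^^ 1) (Some (Sim (num_states M) (z \<noteq> [])), X' # U' # (B, 0) # Z # (block w, int w) # Os @ Ms') =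
      (Some Out, X' # U' # (B, 0) # out_tape (bit_symbol ?res) 0 # (block w, int w) # Os @ Ms')"
      unfolding out0 res .
    then show ?thesis by (intro exI[of _ 1]) auto
  qed
  then obtain l Y' Ms''' where l: "l \<le> q + 4" and
    3: "(r ^^ l) (Some (Sim (num_states M) (z \<noteq> [])), X' # U' # (B, 0) # Z # (block w, int w) # Os @ Ms') =
      (Some Out, X' # U' # (B, 0) # out_tape (bit_symbol ?res) 0 # Y' # Os @ Ms''')" by blast
  obtain Z' B' where Z': "tape_output Z' (False # replicate b False @ [?res])" and
    4: "(r ^^ Suc b) (Some Out, X' # U' # (B, 0) # out_tape (bit_symbol ?res) 0 # Y' # Os @ Ms''') =
      (None, X' # U' # B' # Z' # Y' # Os @ Ms''')"
    using run_out_halt[OF B_iff Os] unfolding r_def by blast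
  note run = funpow_trans[OF funpow_trans[OF funpow_trans[OF 1 2] 3] 4]
  have "2 + Suc (length x) + Suc (length x) + q + j + l + Suc b \<le> 2 * length x + 2 * q + t + b + 10"
    using l j(1) by simp
  moreover have "tape_output ((X' # U' # B' # Z' # Y' # Os @ Ms''') ! 3)
      (False # replicate b False @ [?res])"
    using Z' by simp
  ultimately show ?thesis using run unfolding r_def by blast
qed

section \<open>Computability of the counting predicate\<close>

lemma polytime_computable_extracted:
  fixes T :: "nat poly" and ys :: "bool list \<Rightarrow> bool list \<Rightarrow> bool list"
  assumes wf: "wf_tm M" and K: "4 \<le> num_tapes M"
    and out: "\<And>x u. outputs_within M [x, u, [True, True]] (poly T (length x + length u + 2)) (ys x u)"
    and acc: "\<And>x u. acc x u \<longleftrightarrow>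
      (let q = (length x + 2) ^ k; z = dropWhile Not (take q u)
       in z \<noteq> [] \<and> extracted (length z + 1) (ys x (drop q u)))"
  shows "polytime_computable (\<lambda>(x, u, b). if acc x u then 2 ^ b else 0)"
proof -
  let ?K = "k + num_tapes M + 3"
  obtain N where N: "wf_tm N" "num_tapes N = ?K" and
    run: "\<And>t tps tps'. (run_step (counter_delta M k) ^^ t) (Some Start, tps) = (None, tps') \<Longrightarrow>
      (step N ^^ t) (0, tps) = (num_states N, tps')"
  proof (rule tm_of_transition[of "counter_states M k" Start "num_symbols M" "counter_delta M k" ?K])
    show "Start \<in> counter_states M k" by (simp add: counter_states_def)
    show "3 \<le> num_symbols M" using wf by (simp add: wf_tm_def)
  qed (use finite_counter_states counter_delta_closed counter_delta_wf[OF wf K] in blast)+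
  \<comment> \<open>\<open>[:10, 3:]\<close> pays for the terms linear in \<open>length x\<close>
    and \<open>b\<close>. The shift \<open>[:2, 1:]\<close> dominates both the base
    \<open>length x + 2\<close> and the input size of the simulated run, whose precision is
    2.\<close>
  define T' where "T' = [:10, 3:] + 2 * [:2, 1:] ^ k + pcompose T [:2, 1:]"
  have T': "poly T' m = 10 + 3 * m + 2 * (m + 2) ^ k + poly T (m + 2)" for m
    by (simp add: T'_def poly_pcompose add.commute mult.commute)
  have "outputs_within N [x, u, replicate b True] (poly T' (length x + length u + b))
      (False # replicate b False @ [acc x u])" for x u b
  proof -
    define q where "q = (length x + 2) ^ k"
    obtain t' tps where t': "t' \<le> 2 * length x + 2 * q + poly T (length x + length (drop q u) + 2) + b + 10"
      and halt: "(run_step (counter_delta M k) ^^ t') (Some Start, counter_tapes M k x u b) = (None, tps)"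
      and tape: "tape_output (tps ! 3) (False # replicate b False @ [acc x u])"
      using counter_run[OF wf K q_def refl out, of u b]
      unfolding acc Let_def q_def[symmetric] by blast
    have "initial_config N [x, u, replicate b True] = (0, counter_tapes M k x u b)"
      using N(2) by (simp add: initial_config_def counter_tapes_def)
    then have "outputs_within N [x, u, replicate b True] t' (False # replicate b False @ [acc x u])"
      using run[OF halt] tape by (simp add: outputs_within_def numeral_3_eq_3)
    moreover have "t' \<le> poly T' (length x + length u + b)"
    proof -
      have "q \<le> (length x + length u + b + 2) ^ k"
        unfolding q_def by (intro power_mono) auto
      moreover have "poly T (length x + length (drop q u) + 2) \<le> poly T (length x + length u + b + 2)"
        by (intro poly_mono_nat) auto
      ultimately show ?thesis using t' unfolding T' distrib_left by linarith
    qed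
    ultimately show ?thesis by (rule outputs_within_mono)
  qed
  moreover have "int_of_bits (False # replicate b False @ [acc x u]) =
      (\<lambda>(x, u, b). if acc x u then 2 ^ b else 0) (x, u, b)" for x u b
    using int_of_bits_single[of b "acc x u"] by simp
  moreover have "4 \<le> num_tapes N" using N(2) K by simp
  ultimately show ?thesis
    unfolding polytime_computable_def using N(1) by blast
qed

lemma int_of_bits_le: "int_of_bits (s # bs) \<le> (if s then 0 else int (horner_sum of_bool 2 bs))"
  by (simp flip: int_horner_sum)

text \<open>Dividing \<open>V + 1\<close> by 4 discards two bits, so bit \<open>m\<close> of
  \<open>W\<close> is bit \<open>m + 2\<close> of \<open>V + 1\<close>; this is the reason for the
  two excess marks. In the other case the value is at most 0, and \<open>4 * W \<le> 1\<close>
  forces \<open>W = 0\<close>.\<close>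

lemma extracted_iff:
  assumes "\<bar>4 * int W - int_of_bits ys\<bar> \<le> 1"
  shows "extracted (m + 2) ys \<longleftrightarrow> odd (W div 2 ^ m)"
proof (cases "\<exists>bs. ys = False # bs")
  case True
  then obtain bs where bs: "ys = False # bs" by blast
  define V :: nat where "V = horner_sum of_bool 2 bs"
  have "int_of_bits ys = int V" by (simp add: bs V_def int_horner_sum)
  then have "(V + 1) div 4 = W" using assms by linarith
  then have "(V + 1) div (4 * 2 ^ m) = W div 2 ^ m"
    by (simp only: div_mult2_eq)
  then show ?thesis by (simp add: extracted_def bs carry_bit_iff V_def)
next
  case False
  then have "int_of_bits ys \<le> 0"
    using int_of_bits_le[of True "tl ys"] by (cases ys; cases "hd ys") (auto simp del: int_of_bits.simps(2))
  then have "W = 0" using assms by linarith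
  then show ?thesis using False by (simp add: extracted_def)
qed

text \<open>A magnitude of \<open>length bs\<close> bits is below \<open>2 ^ length bs\<close>, and
  \<open>4 * W\<close> exceeds the denoted integer by at most 1. The empty word denotes 0 and forces
  \<open>W = 0\<close>.\<close>

lemma less_power_length:
  assumes "\<bar>4 * int W - int_of_bits ys\<bar> \<le> 1"
  shows "W < 2 ^ length ys"
proof (cases ys)
  case (Cons s bs)
  have "int_of_bits ys \<le> int (horner_sum of_bool 2 bs)"
    using int_of_bits_le[of s bs] Cons by (auto split: if_splits)
  also have "\<dots> < int (2 ^ length bs)" using horner_sum_less by (simp only: of_nat_less_iff)
  finally have "4 * int W \<le> int (2 ^ length bs)" using assms by linarith
  also have "\<dots> < int (4 * 2 ^ length ys)" using Cons by simp
  finally show ?thesis by linarith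
qed (use assms in auto)

section \<open>Counting with natural weights\<close>

lemma weighted_count_Nats_imp_binary:
  assumes "weighted_counting_problem p w" "range w \<subseteq> \<nat>"
  obtains p' w' where "weighted_counting_problem p' w'" "range w' \<subseteq> {0, 1}"
    "weighted_count p w = weighted_count p' w'"
proof -
  obtain v where "polytime_computable v"
    and approx: "\<And>x u b. \<bar>w (x, u) - real_of_int (v (x, u, b)) / 2 ^ b\<bar> \<le> 1 / 2 ^ b"
    using assms(1) by (auto simp: weighted_counting_problem_def polytime_approximable_def)
  then obtain M and T :: "nat poly" where M: "wf_tm M" "4 \<le> num_tapes M"
    and comp: "\<And>x u b. \<exists>ys. outputs_within M [x, u, replicate b True]
        (poly T (length x + length u + b)) ys \<and> int_of_bits ys = v (x, u, b)"
    unfolding polytime_computable_def by blast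
  have "\<exists>ys. outputs_within M [x, u, [True, True]] (poly T (length x + length u + 2)) ys \<and>
      int_of_bits ys = v (x, u, 2)" for x u
    using comp[of x u 2] by (simp add: numeral_2_eq_2)
  then obtain ys where ys: "\<And>x u. outputs_within M [x, u, [True, True]]
      (poly T (length x + length u + 2)) (ys x u)" "\<And>x u. int_of_bits (ys x u) = v (x, u, 2)"
    by metis
  define W where "W x u = nat \<lfloor>w (x, u)\<rfloor>" for x u
  have W: "w (x, u) = real (W x u)" for x u
  proof -
    have "w (x, u) \<in> \<nat>" using assms(2) by auto
    then show ?thesis by (auto simp: W_def elim!: Nats_cases)
  qed
  have close: "\<bar>4 * int (W x u) - int_of_bits (ys x u)\<bar> \<le> 1" for x u
    using approx[of x u 2] by (simp add: W ys(2) power2_eq_square abs_if split: if_splits)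
  have poly_p: "polynomial_nat p" using assms(1) by (simp add: weighted_counting_problem_def)
  obtain k where k: "\<And>n. poly T (n + p n + 2) \<le> (n + 2) ^ k"
    using polynomial_nat_le_power[OF poly_p] by blast
  define q where "q n = (n + 2) ^ k" for n :: nat
  define acc where
    "acc x u = selected_bit (take (q (length x)) u) (W x (drop (q (length x)) u))" for x u
  define w' :: "bool list \<times> bool list \<Rightarrow> real" where "w' = (\<lambda>(x, u). of_bool (acc x u))"
  define p' where "p' n = q n + p n" for n
  have "acc x u \<longleftrightarrow> (let q = (length x + 2) ^ k; z = dropWhile Not (take q u)
       in z \<noteq> [] \<and> extracted (length z + 1) (ys x (drop q u)))" for x u
  proof -
    have "z \<noteq> [] \<and> odd (W x u div 2 ^ (length z - 1)) \<longleftrightarrow>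
        z \<noteq> [] \<and> extracted (length z + 1) (ys x u)" for z :: "bool list" and u
      using extracted_iff[OF close, of "length z - 1" x u] by (cases z) simp_all
    then show ?thesis by (simp only: acc_def selected_bit_def Let_def q_def)
  qed
  then have "polytime_computable (\<lambda>(x, u, b). if acc x u then 2 ^ b else 0)"
    by (intro polytime_computable_extracted[OF M ys(1), where k = k])
  then have "polytime_approximable w'"
    \<comment> \<open>The integer \<open>2 ^ b\<close> or 0 represents the new weight without error
      at every precision.\<close>
    unfolding polytime_approximable_def by (intro exI conjI) (auto simp: w'_def)
  moreover have "polynomial_nat p'"
  proof -
    obtain P where "\<And>n. real (p n) = poly P (real n)"
      using poly_p by (auto simp: polynomial_nat_def)
    then have "\<And>n. real (p' n) = poly ([:2, 1:] ^ k + P) (real n)"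
      by (simp add: p'_def q_def add.commute)
    then show ?thesis unfolding polynomial_nat_def by blast
  qed
  moreover have "weighted_count p w x = weighted_count p' w' x" for x
  proof -
    let ?n = "length x"
    \<comment> \<open>The words \<open>y\<close> count \<open>W x u\<close> only modulo
      \<open>2 ^ q ?n\<close>; the bound on the output length of \<open>M\<close> removes the
      modulus.\<close>
    have "W x u < 2 ^ q ?n" if "length u = p ?n" for u
    proof -
      have "length (ys x u) \<le> poly T (?n + p ?n + 2)"
        using length_output_le[OF M(1) _ ys(1)[of x u]] M(2) that by simp
      then have "length (ys x u) \<le> q ?n" using k[of ?n] by (simp add: q_def)
      then have "(2 :: nat) ^ length (ys x u) \<le> 2 ^ q ?n" by (intro power_increasing) auto
      then show ?thesis using less_power_length[OF close, of x u] by linarith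
    qed
    then have sum: "(\<Sum>y | length y = q ?n. of_bool (selected_bit y (W x u))) = W x u"
      if "length u = p ?n" for u
      using that by (simp add: sum_selected_bit)
    have "weighted_count p' w' x =
        real (\<Sum>u | length u = q ?n + p ?n. of_bool (acc x u))"
      by (simp add: weighted_count_def p'_def w'_def)
    also have "(\<Sum>u | length u = q ?n + p ?n. of_bool (acc x u)) =
        (\<Sum>u | length u = p ?n. \<Sum>y | length y = q ?n. of_bool (selected_bit y (W x u)) :: nat)"
      unfolding acc_def by (rule sum_length_add)
    also have "\<dots> = (\<Sum>u | length u = p ?n. W x u)"
      by (intro sum.cong refl) (simp add: sum)
    finally show ?thesis by (simp add: weighted_count_def W)
  qed
  ultimately show ?thesis
    by (intro that[of p' w']) (auto simp: weighted_counting_problem_def w'_def)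
qed

theorem theorem3: "sharp_P {0, 1} = sharp_P \<nat>"
proof
  have "{0, 1 :: real} \<subseteq> \<nat>" by auto
  then show "sharp_P {0, 1} \<subseteq> sharp_P \<nat>"
    unfolding sharp_P_def by blast
  show "sharp_P \<nat> \<subseteq> sharp_P {0, 1}"
  proof
    fix f assume "f \<in> sharp_P \<nat>"
    then obtain p w where f: "f = weighted_count p w" and
      pw: "weighted_counting_problem p w" "range w \<subseteq> \<nat>"
      unfolding sharp_P_def by blast
    obtain p' w' where "weighted_counting_problem p' w'" "range w' \<subseteq> {0, 1}"
      "weighted_count p w = weighted_count p' w'"
      using weighted_count_Nats_imp_binary[OF pw] by metis
    then show "f \<in> sharp_P {0, 1}"
      unfolding sharp_P_def f by blast
  qed
qed

end
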